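(* Let $d\in\mathbb{N}$, let $K\subset\mathbb{R}^d$ be a convex compact set, and let $\Delta\subset C(K)$ be the set of all convex and continuous functions on $K$. Then: (a) The set $D:=\{l_1,\dots,l_{d+1}\}$ is an SG-set of $\Delta$, where, for $(x_1,\dots,x_d)\in K$, $$l_j(x_1,\dots,x_d)=x_j,\quad j=1,\dots,d,\qquad l_{d+1}(x_1,\dots,x_d)=-(x_1+\dots+x_d).$$ (b) If $K$ has non-empty interior, then the minimal cardinality of an SG-set of $\Delta$ is equal to $d+1$.
   Context: For a compact set $K\subset\mathbb{R}^d$, $C(K)$ is the space of continuous real-valued functions on $K$ with the uniform norm $\|f\|_{C(K)}=\max_{x\in K}|f(x)|$. For $X\subset C(K)$, $\overline{X}$ denotes the closure of $X$ in this norm. A continuous function $f$ on a convex set is called convex if $\frac{f(x_1)+f(x_2)}{2}\ge f\left(\frac{x_1+x_2}{2}\right)$ for all $x_1,x_2$ in that set. A set $A\subseteq C(K)$ is called a real algebra with unity if $A$ is a real linear space, $fg\in A$ whenever $f,g\in A$, and the constant function $1$ belongs to $A$. Let $\Delta\subseteq C(K)$. A set $D\subseteq\overline{\Delta}$ is called an SG-set (shape generating set) of $\Delta$ if for all real algebras with unity $A\subseteq C(K)$ such that $D\subseteq\overline{A\cap\Delta}$, we have $\Delta\subseteq\overline{A\cap\Delta}$. *)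

theory Defs
  imports "HOL-Analysis.Analysis"
begin

(* C(K) is the metric space cfunspace of bounded continuous maps, carrying the supremum distance.
   Its elements are extensional functions (undefined outside K), so that equality of elements is
   equality on K and the cardinality of a subset of C(K) is the intended one. Boundedness is
   automatic for compact K. *)
abbreviation C_metric :: "'a::topological_space set \<Rightarrow> ('a \<Rightarrow> real) metric" where
  "C_metric K \<equiv> cfunspace (top_of_set K) euclidean_metric"

definition C_space :: "'a::topological_space set \<Rightarrow> ('a \<Rightarrow> real) set" where
  "C_space K = mspace (C_metric K)"

definition unif_closure :: "'a::topological_space set \<Rightarrow> ('a \<Rightarrow> real) set \<Rightarrow> ('a \<Rightarrow> real) set" where
  "unif_closure K X = (mtopology_of (C_metric K)) closure_of X"

lemma C_space_compact:
  assumes "compact K"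
  shows "C_space K = {f \<in> extensional K. continuous_on K f}"
proof -
  have "bounded (f ` K)" if "continuous_on K f" for f :: "'a \<Rightarrow> real"
    using assms that by (intro compact_imp_bounded compact_continuous_image)
  then show ?thesis
    by (auto simp: C_space_def)
qed

lemma unif_closure_iff:
  assumes "compact K" "X \<subseteq> C_space K"
  shows "f \<in> unif_closure K X \<longleftrightarrow>
    f \<in> C_space K \<and> (\<forall>e>0. \<exists>g\<in>X. \<forall>x\<in>K. \<bar>f x - g x\<bar> \<le> e)"
proof -
  interpret M: Metric_space "mspace (C_metric K)" "mdist (C_metric K)"
    by (rule Metric_space_mspace_mdist)
  have le: "mdist (C_metric K) f g \<le> e \<longleftrightarrow> (\<forall>x\<in>K. \<bar>f x - g x\<bar> \<le> e)"
    if "f \<in> C_space K" "g \<in> C_space K" "e > 0" for f g :: "'a \<Rightarrow> real" and e :: real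
  proof (cases "K = {}")
    case True
    then show ?thesis
      using that by (simp add: mdist_cfunspace_eq_mdist_funspace)
  next
    case False
    then show ?thesis
      using that cfunspace_mdist_le[of f "top_of_set K" euclidean_metric g e]
      unfolding C_space_def by (simp del: mspace_cfunspace add: dist_real_def)
  qed
  have "f \<in> unif_closure K X \<longleftrightarrow>
      f \<in> C_space K \<and> (\<forall>e>0. \<exists>g\<in>X. mdist (C_metric K) f g < e)"
    using assms(2) unfolding unif_closure_def mtopology_of_def M.metric_closure_of
    by (auto simp: C_space_def M.in_mball simp del: mspace_cfunspace; blast)
  also have "\<dots> \<longleftrightarrow> f \<in> C_space K \<and> (\<forall>e>0. \<exists>g\<in>X. mdist (C_metric K) f g \<le> e)"
    by (meson dense less_imp_le order_le_less_trans)
  finally show ?thesis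
    using le assms(2) by (meson subsetD)
qed

(* The library's convex_on has arbitrary weights instead of midpoints. *)
definition midpoint_convex_on :: "'a::real_vector set \<Rightarrow> ('a \<Rightarrow> real) \<Rightarrow> bool" where
  "midpoint_convex_on K f \<longleftrightarrow>
     (\<forall>x\<in>K. \<forall>y\<in>K. (f x + f y) / 2 \<ge> f (midpoint x y))"

definition convex_functions :: "'a::real_normed_vector set \<Rightarrow> ('a \<Rightarrow> real) set" where
  "convex_functions K = {f \<in> C_space K. midpoint_convex_on K f}"

(* Operations are restricted to K to stay extensional; the zero function is 0 times the unity. *)
definition unital_algebra :: "'a::topological_space set \<Rightarrow> ('a \<Rightarrow> real) set \<Rightarrow> bool" where
  "unital_algebra K A \<longleftrightarrow>
     A \<subseteq> C_space K \<and>
     (\<forall>f\<in>A. \<forall>g\<in>A. (\<lambda>x\<in>K. f x + g x) \<in> A) \<and>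
     (\<forall>c. \<forall>f\<in>A. (\<lambda>x\<in>K. c * f x) \<in> A) \<and>
     (\<forall>f\<in>A. \<forall>g\<in>A. (\<lambda>x\<in>K. f x * g x) \<in> A) \<and>
     (\<lambda>x\<in>K. 1) \<in> A"

definition SG_set :: "'a::topological_space set \<Rightarrow> ('a \<Rightarrow> real) set \<Rightarrow> ('a \<Rightarrow> real) set \<Rightarrow> bool" where
  "SG_set K \<Delta> D \<longleftrightarrow>
     D \<subseteq> unif_closure K \<Delta> \<and>
     (\<forall>A. unital_algebra K A \<longrightarrow> D \<subseteq> unif_closure K (A \<inter> \<Delta>)
        \<longrightarrow> \<Delta> \<subseteq> unif_closure K (A \<inter> \<Delta>))"

definition coord_fun :: "(real ^ 'n) set \<Rightarrow> 'n \<Rightarrow> real ^ 'n \<Rightarrow> real" where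
  "coord_fun K j = (\<lambda>x\<in>K. x $ j)"

definition neg_coord_sum :: "(real ^ 'n::finite) set \<Rightarrow> real ^ 'n \<Rightarrow> real" where
  "neg_coord_sum K = (\<lambda>x\<in>K. - (\<Sum>j\<in>UNIV. x $ j))"

end

theory Submission
  imports Defs
begin

text \<open>
  Throughout, \<open>\<Delta>\<close> is the set of convex functions in \<open>C(K)\<close>, and \<open>A\<close> is a unital algebra.

  That the coordinates and their negative sum suffice rests on one observation: the closure of
  \<open>A \<inter> \<Delta>\<close> is not only a convex cone containing the constants, it is also closed under binary
  maxima (\<open>approximable_max\<close>). Indeed \<open>max s t = (s + t) / 2 + \<bar>s - t\<bar> / 2\<close>, and the absolute value
  can be replaced by a nearby polynomial \<open>q\<close> that is still convex and 1-Lipschitz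
  (\<open>convex_polynomial_near_abs\<close>). The Lipschitz bound makes \<open>(s + t) / 2 + q (s - t) / 2\<close>
  nondecreasing in each variable, so that it turns two convex elements of \<open>A\<close> into a convex element
  of \<open>A\<close>. Every affine function is a constant plus a combination of the given functions with
  nonnegative coefficients, since adding a multiple of \<open>\<Sum>j. x\<^sub>j\<close> can make all the coefficients of the
  \<open>x\<^sub>j\<close> nonnegative; and a continuous convex function on a compact convex set is a limit of finite
  maxima of affine functions.

  For the lower bound let \<open>D\<close> consist of at most \<open>n\<close> convex functions on a set \<open>K\<close> with interior in an
  \<open>n\<close>-dimensional space. At an interior point \<open>x\<^sub>0\<close> choose a subgradient \<open>v\<^sub>f\<close> for each \<open>f\<close> in \<open>D\<close>. So
  few vectors lie in a closed half-space: there is \<open>w \<noteq> 0\<close> with \<open>v\<^sub>f \<bullet> w \<ge> 0\<close> for all \<open>f\<close>. What is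
  needed is an algebra whose convex elements cannot decrease at \<open>x\<^sub>0\<close> in the direction \<open>w\<close>, but which
  still has convex elements close to every \<open>f\<close> in \<open>D\<close>. Take all functions \<open>h\<close> such that, for some \<open>b\<close>,

    \<open>h (x\<^sub>0 + t w) = h x\<^sub>0 + b t + b \<bar>t\<bar>\<^bsup>3/2\<^esup> + o(\<bar>t\<bar>\<^bsup>3/2\<^esup>)\<close>.

  They form an algebra because \<open>t\<^sup>2 = o(\<bar>t\<bar>\<^bsup>3/2\<^esup>)\<close>, so that \<open>b\<close> obeys the product rule (\<open>cusp_mult\<close>). If
  \<open>h\<close> is convex, its second difference at \<open>x\<^sub>0\<close> is nonnegative; but this difference is
  \<open>2 b \<bar>t\<bar>\<^bsup>3/2\<^esup>\<close> to leading order, so the slope \<open>b\<close> itself is nonnegative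
  (\<open>convex_cusp_nonneg\<close>). Hence the convex function \<open>- w \<bullet> x\<close> is not a limit of convex elements. On the
  other hand, a function with nonnegative slope is approximated (\<open>approximable_cusp_algebra\<close>) by
  placing on it, near \<open>x\<^sub>0\<close>, a slightly raised supporting affine function to which \<open>b\<close> times a flat
  convex function with the germ \<open>\<bar>t\<bar>\<^bsup>3/2\<^esup>\<close> has been added.
\<close>

section \<open>Continuous convex functions\<close>

text \<open>
  On a segment, subtract from \<open>f\<close> the linear function with the same end values. If the maximum of the
  difference were positive, then at the last point where it is attained the midpoint inequality would
  fail for two equidistant neighbours, because the one on the right has a smaller value.
\<close>
lemma midpoint_convex_imp_convex_on:
  fixes f :: "'a::real_normed_vector \<Rightarrow> real"
  assumes "convex K" "continuous_on K f" "midpoint_convex_on K f"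
  shows "convex_on K f"
proof (rule convex_onI)
  fix t x y assume t: "0 < t" "t < (1::real)" and xy: "x \<in> K" "y \<in> K"
  define \<psi> where "\<psi> s = f ((1 - s) *\<^sub>R x + s *\<^sub>R y) - ((1 - s) * f x + s * f y)" for s
  have in_K: "(1 - s) *\<^sub>R x + s *\<^sub>R y \<in> K" if "s \<in> {0..1}" for s
    using assms(1) xy that by (auto simp: convex_alt)
  have cont: "continuous_on {0..1} \<psi>"
    unfolding \<psi>_def using in_K
    by (intro continuous_intros continuous_on_compose2[OF assms(2)]) auto
  obtain m where m: "m \<in> {0..1}" "\<And>s. s \<in> {0..1} \<Longrightarrow> \<psi> s \<le> \<psi> m"
    using continuous_attains_sup[OF _ _ cont] by auto
  have "compact {s \<in> {0..1}. \<psi> s = \<psi> m}"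
    using continuous_on_closed_Collect_le continuous_closed_preimage_constant[OF cont, of "\<psi> m"]
    by (auto simp: compact_eq_bounded_closed intro: bounded_subset[of "{0..1}"])
  then obtain r where r: "r \<in> {0..1}" "\<psi> r = \<psi> m" "\<And>s. s \<in> {0..1} \<Longrightarrow> \<psi> s = \<psi> m \<Longrightarrow> s \<le> r"
    using compact_attains_sup[of "{s \<in> {0..1}. \<psi> s = \<psi> m}"] m(1) by auto
  have "\<psi> m \<le> 0"
  proof (rule ccontr)
    assume pos: "\<not> \<psi> m \<le> 0"
    have "\<psi> 0 = 0" "\<psi> 1 = 0" by (simp_all add: \<psi>_def)
    then have "r \<noteq> 0" "r \<noteq> 1" using r(2) pos by auto
    then have "0 < r" "r < 1" using r(1) by auto
    define h where "h = min r (1 - r)"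
    have h: "0 < h" "r - h \<in> {0..1}" "r + h \<in> {0..1}"
      using \<open>0 < r\<close> \<open>r < 1\<close> by (auto simp: h_def)
    have mid: "midpoint ((1 - (r - h)) *\<^sub>R x + (r - h) *\<^sub>R y) ((1 - (r + h)) *\<^sub>R x + (r + h) *\<^sub>R y)
        = (1 - r) *\<^sub>R x + r *\<^sub>R y"
      unfolding midpoint_eq_iff by (simp add: algebra_simps)
    have "\<psi> r \<le> (\<psi> (r - h) + \<psi> (r + h)) / 2"
      using assms(3)[unfolded midpoint_convex_on_def, rule_format, OF in_K[OF h(2)] in_K[OF h(3)]]
      unfolding mid \<psi>_def by (simp add: field_simps)
    moreover have "\<psi> (r + h) < \<psi> m"
      using r(3)[OF h(3)] m(2)[OF h(3)] h(1) by force
    ultimately show False using m(2)[OF h(2)] r(2) by argo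
  qed
  then have "\<psi> t \<le> 0" using m(2)[of t] t by simp
  then show "f ((1 - t) *\<^sub>R x + t *\<^sub>R y) \<le> (1 - t) * f x + t * f y"
    by (simp add: \<psi>_def)
qed (fact assms)

lemma midpoint_mem_convex:
  fixes K :: "'a::real_normed_vector set"
  assumes "convex K" "x \<in> K" "y \<in> K"
  shows "midpoint x y \<in> K"
  using assms midpoints_in_convex_hull[of x K y] by (simp add: hull_same)

lemma restrict_mem_convex_functions:
  assumes "compact K" "convex K"
  shows "(\<lambda>x\<in>K. f x) \<in> convex_functions K \<longleftrightarrow> continuous_on K f \<and> midpoint_convex_on K f"
  using midpoint_mem_convex[OF assms(2)]
  by (auto simp: convex_functions_def C_space_compact[OF assms(1)] midpoint_convex_on_def
      cong: continuous_on_cong)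

lemma convex_functionsD:
  assumes "compact K" "f \<in> convex_functions K"
  shows "continuous_on K f" "midpoint_convex_on K f"
  using assms by (auto simp: convex_functions_def C_space_compact)

text \<open>
  So the members of an SG-set of the convex functions are themselves convex.
\<close>
lemma unif_closure_convex_functions:
  assumes "compact K" "convex K"
  shows "unif_closure K (convex_functions K) = convex_functions K"
proof (intro subset_antisym subsetI)
  fix f assume "f \<in> convex_functions K"
  then show "f \<in> unif_closure K (convex_functions K)"
    using assms(1) by (subst unif_closure_iff) (auto simp: convex_functions_def intro!: bexI[of _ f])
next
  fix f assume "f \<in> unif_closure K (convex_functions K)"
  then have f: "f \<in> C_space K" "\<And>e. e > 0 \<Longrightarrow> \<exists>g\<in>convex_functions K. \<forall>x\<in>K. \<bar>f x - g x\<bar> \<le> e"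
    using assms(1) by (auto simp: unif_closure_iff convex_functions_def)
  have "f (midpoint x y) \<le> (f x + f y) / 2" if xy: "x \<in> K" "y \<in> K" for x y
  proof (rule field_le_epsilon)
    fix e :: real assume "e > 0"
    then obtain g where g: "g \<in> convex_functions K" "\<forall>x\<in>K. \<bar>f x - g x\<bar> \<le> e / 2"
      using f(2)[of "e / 2"] by auto
    have "midpoint x y \<in> K" by (rule midpoint_mem_convex[OF assms(2) xy])
    moreover have "g (midpoint x y) \<le> (g x + g y) / 2"
      using g(1) xy by (auto simp: convex_functions_def midpoint_convex_on_def)
    ultimately show "f (midpoint x y) \<le> (f x + f y) / 2 + e"
      using g(2)[rule_format, of "midpoint x y"] g(2)[rule_format, OF xy(1)] g(2)[rule_format, OF xy(2)]
      by argo
  qed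
  then show "f \<in> convex_functions K"
    using f(1) by (auto simp: convex_functions_def midpoint_convex_on_def)
qed

section \<open>Affine minorants and subgradients\<close>

text \<open>
  Separate the closed convex epigraph from the point \<open>(x\<^sub>0, f x\<^sub>0 - e)\<close>. The separating hyperplane is
  not vertical since \<open>(x\<^sub>0, f x\<^sub>0)\<close> lies above that point. Exact subgradients need not exist at boundary
  points of \<open>K\<close>; this is where the slack \<open>e\<close> is used.
\<close>
lemma convex_function_affine_minorant:
  fixes f :: "'a::euclidean_space \<Rightarrow> real"
  assumes K: "closed K" and f: "convex_on K f" "continuous_on K f" and x0: "x0 \<in> K" and e: "e > 0"
  obtains a b where "\<And>x. x \<in> K \<Longrightarrow> a \<bullet> x + b \<le> f x" "f x0 - e < a \<bullet> x0 + b"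
proof -
  have cl: "closed (epigraph K f)"
  proof -
    have "closed (K \<times> (UNIV :: real set))"
      using K by (intro closed_Times) auto
    moreover have "continuous_on (K \<times> UNIV) (\<lambda>p. f (fst p))"
      by (intro continuous_on_compose2[OF f(2)] continuous_intros) auto
    ultimately have "closed {p \<in> K \<times> UNIV. f (fst p) \<le> snd p}"
      by (intro continuous_on_closed_Collect_le continuous_on_snd continuous_on_id)
    also have "{p \<in> K \<times> UNIV. f (fst p) \<le> snd p} = epigraph K f" by (auto simp: epigraph_def)
    finally show ?thesis .
  qed
  have "(x0, f x0 - e) \<notin> epigraph K f" using e by (simp add: mem_epigraph)
  then obtain n c where nc: "n \<bullet> (x0, f x0 - e) < c" "\<And>p. p \<in> epigraph K f \<Longrightarrow> c < n \<bullet> p"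
    using separating_hyperplane_closed_point[OF convex_epigraphI[OF f(1)] cl] by blast
  obtain p s where n: "n = (p, s)" by fastforce
  have above: "c < p \<bullet> x + s * f x" if "x \<in> K" for x
    using nc(2)[of "(x, f x)"] that by (simp add: n mem_epigraph)
  have below: "p \<bullet> x0 + s * f x0 - s * e < c"
    using nc(1) by (simp add: n algebra_simps)
  have "s * e > 0" using above[OF x0] below by linarith
  then have s: "s > 0" using e by (simp add: zero_less_mult_iff)
  show thesis
  proof
    fix x assume "x \<in> K"
    from above[OF this] show "(- (1 / s) *\<^sub>R p) \<bullet> x + c / s \<le> f x"
      using s by (simp add: field_simps)
  next
    show "f x0 - e < (- (1 / s) *\<^sub>R p) \<bullet> x0 + c / s"
      using below s by (simp add: field_simps)
  qed
qed

lemma convex_function_finite_affine_max: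
  fixes f :: "'a::euclidean_space \<Rightarrow> real"
  assumes K: "compact K" "K \<noteq> {}" and f: "convex_on K f" "continuous_on K f" and e: "e > 0"
  obtains I where "finite I" "I \<noteq> {}"
    "\<And>x. x \<in> K \<Longrightarrow> \<bar>f x - Max ((\<lambda>(a, b). a \<bullet> x + b) ` I)\<bar> \<le> e"
proof -
  define M where "M = {(a, b). \<forall>x\<in>K. a \<bullet> x + b \<le> f x}"
  define U where "U = (\<lambda>(a, b). {x \<in> K. f x - e < a \<bullet> x + b})"
  have "openin (top_of_set K) (U i)" for i
  proof (cases i)
    case (Pair a b)
    have "openin (top_of_set K) (K \<inter> (\<lambda>x. f x - (a \<bullet> x + b)) -` {..<e})"
      by (intro continuous_openin_preimage_gen continuous_intros f)
    also have "K \<inter> (\<lambda>x. f x - (a \<bullet> x + b)) -` {..<e} = U i" by (auto simp: U_def Pair)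
    finally show ?thesis .
  qed
  moreover have "K \<subseteq> \<Union> (U ` M)"
  proof
    fix x assume x: "x \<in> K"
    obtain a b where "\<And>y. y \<in> K \<Longrightarrow> a \<bullet> y + b \<le> f y" "f x - e < a \<bullet> x + b"
      using convex_function_affine_minorant[OF compact_imp_closed[OF K(1)] f x e] by blast
    then have "(a, b) \<in> M" "x \<in> U (a, b)" using x by (auto simp: M_def U_def)
    then show "x \<in> \<Union> (U ` M)" by blast
  qed
  ultimately obtain \<D> where "\<D> \<subseteq> U ` M" "finite \<D>" "K \<subseteq> \<Union> \<D>"
    using K(1) unfolding compact_eq_openin_cover by (metis imageE)
  then obtain I where I: "I \<subseteq> M" "finite I" "K \<subseteq> \<Union> (U ` I)"
    by (metis finite_subset_image)
  have ne: "I \<noteq> {}" using I(3) K(2) by auto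
  show thesis
  proof
    fix x assume x: "x \<in> K"
    have "Max ((\<lambda>(a, b). a \<bullet> x + b) ` I) \<le> f x"
      using I(1,2) ne x by (auto simp: M_def)
    moreover obtain i where i: "i \<in> I" "f x - e < (\<lambda>(a, b). a \<bullet> x + b) i"
      using I(3) x by (auto simp: U_def)
    then have "(\<lambda>(a, b). a \<bullet> x + b) i \<le> Max ((\<lambda>(a, b). a \<bullet> x + b) ` I)"
      using I(2) by (intro Max_ge) auto
    ultimately show "\<bar>f x - Max ((\<lambda>(a, b). a \<bullet> x + b) ` I)\<bar> \<le> e" using i(2) by linarith
  qed (fact I ne)+
qed

text \<open>
  Here the epigraph is separated from the open ray below \<open>(x\<^sub>0, f x\<^sub>0)\<close>, which it misses. A vertical
  separating hyperplane would have all of \<open>K\<close> on one side of a hyperplane through \<open>x\<^sub>0\<close>.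
\<close>
lemma convex_function_interior_subgradient:
  fixes f :: "'a::euclidean_space \<Rightarrow> real"
  assumes f: "convex_on K f" and x0: "x0 \<in> interior K"
  shows "\<exists>v. \<forall>x\<in>K. f x0 + v \<bullet> (x - x0) \<le> f x"
proof -
  have x0K: "x0 \<in> K" using x0 interior_subset by blast
  have "convex ({x0} \<times> {..<f x0})" by (intro convex_Times) auto
  moreover have "(x0, f x0 - 1) \<in> {x0} \<times> {..<f x0}" "(x0, f x0) \<in> epigraph K f"
    using x0K by (auto simp: mem_epigraph)
  moreover have "epigraph K f \<inter> {x0} \<times> {..<f x0} = {}" by (auto simp: epigraph_def)
  ultimately obtain n c where n0: "n \<noteq> 0"
    and nc: "\<And>z. z \<in> epigraph K f \<Longrightarrow> n \<bullet> z \<le> c" "\<And>z. z \<in> {x0} \<times> {..<f x0} \<Longrightarrow> c \<le> n \<bullet> z"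
    using separating_hyperplane_sets[OF convex_epigraphI[OF f], of "{x0} \<times> {..<f x0}"] by blast
  obtain p s where n: "n = (p, s)" by fastforce
  have above: "p \<bullet> x + s * f x \<le> c" if "x \<in> K" for x
    using nc(1)[of "(x, f x)"] that by (simp add: n mem_epigraph)
  have below: "c \<le> p \<bullet> x0 + s * (f x0 - e)" if "e > 0" for e
    using nc(2)[of "(x0, f x0 - e)"] that by (simp add: n)
  have "s \<le> 0" using above[OF x0K] below[of 1] by (simp add: algebra_simps)
  have touch: "c \<le> p \<bullet> x0 + s * f x0"
  proof (rule field_le_epsilon)
    fix e :: real assume e: "e > 0"
    \<comment> \<open>The denominator \<open>1 - s\<close> serves for \<open>s = 0\<close> too, which is not yet excluded.\<close>
    have "- s * (e / (1 - s)) \<le> e" using e \<open>s \<le> 0\<close> by (simp add: field_simps)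
    then show "c \<le> p \<bullet> x0 + s * f x0 + e"
      using below[of "e / (1 - s)"] e \<open>s \<le> 0\<close> by (simp add: right_diff_distrib)
  qed
  have "s \<noteq> 0"
  proof
    assume "s = 0"
    then have "p \<noteq> 0" using n n0 by (simp add: zero_prod_def)
    obtain d where d: "d > 0" "cball x0 d \<subseteq> K"
      using x0 by (meson mem_interior_cball)
    have "x0 + (d / norm p) *\<^sub>R p \<in> K"
      using d \<open>p \<noteq> 0\<close> by (intro subsetD[OF d(2)]) (simp add: dist_norm)
    from above[OF this] touch have "(d / norm p) * (p \<bullet> p) \<le> 0"
      using \<open>s = 0\<close> by (simp add: inner_add_right)
    moreover have "(d / norm p) * (p \<bullet> p) > 0" using d(1) \<open>p \<noteq> 0\<close> by simp
    ultimately show False by simp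
  qed
  with \<open>s \<le> 0\<close> have s: "s < 0" by simp
  show ?thesis
  proof (intro exI ballI)
    fix x assume "x \<in> K"
    from above[OF this] touch have "p \<bullet> (x - x0) \<le> - s * (f x - f x0)"
      by (simp add: inner_diff_right algebra_simps)
    then show "f x0 + (- (1 / s) *\<^sub>R p) \<bullet> (x - x0) \<le> f x"
      using s by (simp add: field_simps)
  qed
qed

section \<open>Convex polynomials close to the absolute value\<close>

lemma polynomial_antiderivative:
  fixes p :: "real \<Rightarrow> real"
  assumes "real_polynomial_function p"
  obtains P where "real_polynomial_function P" "P 0 = c" "\<And>x. (P has_real_derivative p x) (at x)"
proof -
  obtain a n where p: "p = (\<lambda>x. \<Sum>i\<le>n. a i * x ^ i)"
    using assms real_polynomial_function_iff_sum by blast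
  let ?P = "\<lambda>x. c + (\<Sum>i\<le>n. a i / (1 + real i) * x ^ Suc i)"
  show thesis
  proof
    have "real_polynomial_function (\<lambda>x :: real. x)"
      by (rule real_polynomial_function.intros(1)[OF bounded_linear_ident])
    then show "real_polynomial_function ?P"
      by (intro real_polynomial_function.intros(2-4) real_polynomial_function_sum
          real_polynomial_function_power) auto
    show "(?P has_real_derivative p x) (at x)" for x
      unfolding p by (rule derivative_eq_intros refl | simp)+ (simp add: mult.commute)
  qed auto
qed

text \<open>
  Approximating \<open>\<bar>t\<bar>\<close> itself by polynomials gives no control of convexity. Instead the smooth function
  \<open>\<phi> t = sqrt (t\<^sup>2 + d\<^sup>2)\<close> has a second derivative that is bounded below by some \<open>m > 0\<close> on the interval;
  a polynomial within \<open>\<eta> \<le> m\<close> of it is nonnegative. Integrating this polynomial twice gives a convex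
  polynomial close to \<open>\<phi>\<close>, whose slope is at most \<open>1 + \<eta> R\<close>; division by \<open>1 + \<eta> R\<close> makes it
  1-Lipschitz.
\<close>
lemma convex_polynomial_near_abs:
  fixes R e :: real
  assumes "0 < R" "0 < e"
  obtains q :: "real \<Rightarrow> real" where "real_polynomial_function q" "convex_on {-R..R} q"
    "\<And>s t. s \<in> {-R..R} \<Longrightarrow> t \<in> {-R..R} \<Longrightarrow> \<bar>q s - q t\<bar> \<le> \<bar>s - t\<bar>"
    "\<And>t. t \<in> {-R..R} \<Longrightarrow> \<bar>q t - \<bar>t\<bar>\<bar> \<le> e"
proof -
  define d where "d = e / 2"
  have d: "d > 0" using assms by (simp add: d_def)
  define \<phi> where "\<phi> t = sqrt (t\<^sup>2 + d\<^sup>2)" for t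
  have pos: "t\<^sup>2 + d\<^sup>2 > 0" for t :: real
    using d by (simp add: add_nonneg_pos)
  have \<phi>_pos: "\<phi> t > 0" and \<phi>_sq: "(\<phi> t)\<^sup>2 = t\<^sup>2 + d\<^sup>2" for t
    using pos[of t] by (auto simp: \<phi>_def)
  have \<phi>1: "(\<phi> has_real_derivative t / \<phi> t) (at t)" for t
    unfolding \<phi>_def using pos[of t] by (auto intro!: derivative_eq_intros simp: field_simps)
  have \<phi>2: "((\<lambda>t. t / \<phi> t) has_real_derivative d\<^sup>2 / \<phi> t ^ 3) (at t)" for t
  proof -
    have "((\<lambda>t. t / \<phi> t) has_real_derivative (1 * \<phi> t - t * (t / \<phi> t)) / (\<phi> t * \<phi> t)) (at t)"
      using \<phi>_pos[of t] by (intro DERIV_divide DERIV_ident \<phi>1) auto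
    also have "(1 * \<phi> t - t * (t / \<phi> t)) / (\<phi> t * \<phi> t) = ((\<phi> t)\<^sup>2 - t\<^sup>2) / \<phi> t ^ 3"
      using \<phi>_pos[of t] by (simp add: field_simps power2_eq_square power3_eq_cube)
    finally show ?thesis by (simp add: \<phi>_sq)
  qed
  define m where "m = d\<^sup>2 / \<phi> R ^ 3"
  \<comment> \<open>The errors add up to \<open>2 \<eta> R\<^sup>2 + d\<close>: half of \<open>e\<close> for \<open>d\<close>, half for the rest.\<close>
  define \<eta> where "\<eta> = min m (e / (4 * R\<^sup>2))"
  have \<eta>: "0 < \<eta>" "\<eta> \<le> m" "\<eta> * R\<^sup>2 \<le> e / 4"
    using d assms \<phi>_pos[of R] by (auto simp: \<eta>_def m_def min_def field_simps)
  have m: "m \<le> d\<^sup>2 / \<phi> t ^ 3" if "t \<in> {-R..R}" for t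
  proof -
    have "t\<^sup>2 \<le> R\<^sup>2" using that by (simp add: abs_le_square_iff[symmetric] abs_le_iff)
    then have "\<phi> t \<le> \<phi> R" by (simp add: \<phi>_def)
    then show ?thesis unfolding m_def
      using \<phi>_pos[of t] by (intro divide_left_mono power_mono mult_pos_pos zero_less_power) (auto intro: less_imp_le[OF \<phi>_pos] simp: \<phi>_pos)
  qed
  have "continuous_on {-R..R} (\<lambda>t. d\<^sup>2 / \<phi> t ^ 3)"
    using pos unfolding \<phi>_def by (intro continuous_intros) (auto simp: less_imp_neq[symmetric])
  then obtain p where p: "real_polynomial_function p"
      "\<And>t. t \<in> {-R..R} \<Longrightarrow> \<bar>d\<^sup>2 / \<phi> t ^ 3 - p t\<bar> < \<eta>"
    using Stone_Weierstrass_real_polynomial_function[OF _ _ \<eta>(1), of "{-R..R}"] by blast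
  obtain P where P: "real_polynomial_function P" "P 0 = 0" "\<And>x. (P has_real_derivative p x) (at x)"
    using polynomial_antiderivative[OF p(1)] by blast
  obtain Q where Q: "real_polynomial_function Q" "Q 0 = d" "\<And>x. (Q has_real_derivative P x) (at x)"
    using polynomial_antiderivative[OF P(1)] by blast
  have p_nonneg: "p t \<ge> 0" if "t \<in> {-R..R}" for t
    using p(2)[OF that] m[OF that] \<eta>(2) by linarith
  have PR: "\<bar>P t - t / \<phi> t\<bar> \<le> \<eta> * R" if "t \<in> {-R..R}" for t
  proof -
    have "norm ((P t - t / \<phi> t) - (P 0 - 0 / \<phi> 0)) \<le> \<eta> * norm (t - 0)"
    proof (rule field_differentiable_bound[of "{-R..R}"])
      show "((\<lambda>t. P t - t / \<phi> t) has_real_derivative (p z - d\<^sup>2 / \<phi> z ^ 3)) (at z within {-R..R})" for z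
        by (rule has_field_derivative_at_within[OF DERIV_diff[OF P(3) \<phi>2]])
      show "norm (p z - d\<^sup>2 / \<phi> z ^ 3) \<le> \<eta>" if "z \<in> {-R..R}" for z
        using p(2)[OF that] by (simp add: abs_minus_commute)
    qed (use that assms in auto)
    also have "\<dots> \<le> \<eta> * R" using that \<eta>(1) by (auto intro!: mult_left_mono)
    finally show ?thesis using P(2) by simp
  qed
  have QR: "\<bar>Q t - \<phi> t\<bar> \<le> \<eta> * R\<^sup>2" if "t \<in> {-R..R}" for t
  proof -
    have "norm ((Q t - \<phi> t) - (Q 0 - \<phi> 0)) \<le> \<eta> * R * norm (t - 0)"
    proof (rule field_differentiable_bound[of "{-R..R}"])
      show "((\<lambda>t. Q t - \<phi> t) has_real_derivative (P z - z / \<phi> z)) (at z within {-R..R})" for z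
        by (rule has_field_derivative_at_within[OF DERIV_diff[OF Q(3) \<phi>1]])
    qed (use that assms PR in auto)
    also have "\<dots> \<le> \<eta> * R * R" using that \<eta>(1) assms by (auto intro!: mult_left_mono)
    finally show ?thesis using Q(2) d by (simp add: \<phi>_def power2_eq_square mult.assoc)
  qed
  have P1: "\<bar>P t\<bar> \<le> 1 + \<eta> * R" if "t \<in> {-R..R}" for t
  proof -
    have "\<bar>t\<bar> \<le> \<phi> t" unfolding \<phi>_def by (rule real_le_rsqrt) simp
    then have "\<bar>t / \<phi> t\<bar> \<le> 1" using \<phi>_pos[of t] by (simp add: abs_of_pos)
    with PR[OF that] show ?thesis by linarith
  qed
  define c where "c = 1 / (1 + \<eta> * R)"
  have \<eta>R: "\<eta> * R > 0" using \<eta> assms by simp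
  have c: "0 < c" "c \<le> 1"
    using \<eta>R by (auto simp: c_def)
  have "1 - c = \<eta> * R * c"
    using \<eta>R by (simp add: c_def field_simps)
  then have c1: "1 - c \<le> \<eta> * R"
    using mult_left_mono[OF c(2), of "\<eta> * R"] \<eta>R by simp
  define q where "q = (\<lambda>t. c * Q t)"
  have dq: "(q has_real_derivative c * P t) (at t)" for t
    unfolding q_def using DERIV_cmult[OF Q(3)] by simp
  show thesis
  proof
    show "real_polynomial_function q"
      unfolding q_def by (rule real_polynomial_function.intros(4)[OF real_polynomial_function.intros(2) Q(1)])
    show "convex_on {-R..R} q"
    proof (rule f''_ge0_imp_convex)
      show "((\<lambda>t. c * P t) has_real_derivative c * p t) (at t)" for t
        using DERIV_cmult[OF P(3)] by simp
    qed (use dq p_nonneg c in auto)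
    show "\<bar>q s - q t\<bar> \<le> \<bar>s - t\<bar>" if "s \<in> {-R..R}" "t \<in> {-R..R}" for s t
    proof -
      have "norm (q s - q t) \<le> 1 * norm (s - t)"
      proof (rule field_differentiable_bound[of "{-R..R}"])
        show "(q has_real_derivative c * P z) (at z within {-R..R})" for z
          by (rule has_field_derivative_at_within[OF dq])
        show "norm (c * P z) \<le> 1" if "z \<in> {-R..R}" for z
          using P1[OF that] \<eta>R by (simp add: c_def)
      qed (use that in auto)
      then show ?thesis by simp
    qed
    show "\<bar>q t - \<bar>t\<bar>\<bar> \<le> e" if "t \<in> {-R..R}" for t
    proof -
      have "\<bar>\<phi> t - \<bar>t\<bar>\<bar> \<le> d"
        using sqrt_add_le_add_sqrt[of "t\<^sup>2" "d\<^sup>2"] real_sqrt_le_mono[of "t\<^sup>2" "t\<^sup>2 + d\<^sup>2"] d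
        by (simp add: \<phi>_def)
      then have *: "\<bar>Q t - \<bar>t\<bar>\<bar> \<le> \<eta> * R\<^sup>2 + d" using QR[OF that] by linarith
      have "q t - \<bar>t\<bar> = c * (Q t - \<bar>t\<bar>) - (1 - c) * \<bar>t\<bar>" by (simp add: q_def algebra_simps)
      also have "\<bar>\<dots>\<bar> \<le> c * \<bar>Q t - \<bar>t\<bar>\<bar> + (1 - c) * \<bar>t\<bar>"
        using c by (intro order_trans[OF abs_triangle_ineq4]) (simp add: abs_mult)
      also have "\<dots> \<le> 1 * (\<eta> * R\<^sup>2 + d) + (\<eta> * R) * R"
        using * c c1 that \<eta>R by (intro add_mono mult_mono) auto
      also have "\<dots> \<le> e" using \<eta>(3) by (simp add: d_def power2_eq_square algebra_simps)
      finally show ?thesis .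
    qed
  qed
qed

section \<open>Uniform approximation by the convex elements of an algebra\<close>

text \<open>
  In contrast to membership in the uniform closure, the function need not be extensional. Hence sums,
  multiples and maxima can be written without restricting them to \<open>K\<close>.
\<close>
definition approximable :: "'a set \<Rightarrow> ('a \<Rightarrow> real) set \<Rightarrow> ('a \<Rightarrow> real) \<Rightarrow> bool" where
  "approximable K X f \<longleftrightarrow> (\<forall>e>0. \<exists>g\<in>X. \<forall>x\<in>K. \<bar>f x - g x\<bar> \<le> e)"

lemma mem_unif_closure_algebra_convex:
  assumes "compact K"
  shows "f \<in> unif_closure K (A \<inter> convex_functions K) \<longleftrightarrow>
    f \<in> C_space K \<and> approximable K (A \<inter> convex_functions K) f"
  using assms by (subst unif_closure_iff) (auto simp: convex_functions_def approximable_def)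

context
  fixes K :: "'a::topological_space set" and A
  assumes A: "unital_algebra K A"
begin

lemma algebra_add: "f \<in> A \<Longrightarrow> g \<in> A \<Longrightarrow> (\<lambda>x\<in>K. f x + g x) \<in> A"
  and algebra_scale: "f \<in> A \<Longrightarrow> (\<lambda>x\<in>K. c * f x) \<in> A"
  and algebra_mult: "f \<in> A \<Longrightarrow> g \<in> A \<Longrightarrow> (\<lambda>x\<in>K. f x * g x) \<in> A"
  using A by (auto simp: unital_algebra_def)

lemma algebra_const: "(\<lambda>x\<in>K. c) \<in> A"
proof -
  have "(\<lambda>x\<in>K. c * (\<lambda>x\<in>K. 1) x) \<in> A"
    using A unfolding unital_algebra_def by blast
  then show ?thesis by (simp cong: restrict_cong)
qed

lemma algebra_polynomial:
  fixes q :: "real \<Rightarrow> real"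
  assumes "real_polynomial_function q" "f \<in> A"
  shows "(\<lambda>x\<in>K. q (f x)) \<in> A"
  using assms(1)
proof induction
  case (linear q)
  have "q (f x) = q 1 * f x" for x
    using linear_scale[OF bounded_linear.linear[OF linear], of "f x" 1] by simp
  then have "(\<lambda>x. q (f x)) = (\<lambda>x. q 1 * f x)" by (rule ext)
  then show ?case using algebra_scale[OF assms(2), of "q 1"] by (simp only:)
next
  case (add p q)
  have "(\<lambda>x\<in>K. (\<lambda>x\<in>K. p (f x)) x + (\<lambda>x\<in>K. q (f x)) x) = (\<lambda>x\<in>K. p (f x) + q (f x))"
    by (rule restrict_ext) simp
  then show ?case using algebra_add[OF add.IH] by (simp only:)
next
  case (mult p q)
  have "(\<lambda>x\<in>K. (\<lambda>x\<in>K. p (f x)) x * (\<lambda>x\<in>K. q (f x)) x) = (\<lambda>x\<in>K. p (f x) * q (f x))"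
    by (rule restrict_ext) simp
  then show ?case using algebra_mult[OF mult.IH] by (simp only:)
qed (rule algebra_const)

end

context
  fixes K :: "'a::real_normed_vector set" and A
  assumes K: "compact K" "convex K" and A: "unital_algebra K A"
begin

lemma approximable_const: "approximable K (A \<inter> convex_functions K) (\<lambda>x. c)"
proof -
  have "(\<lambda>x\<in>K. c) \<in> A \<inter> convex_functions K"
    using algebra_const[OF A] by (simp add: restrict_mem_convex_functions[OF K] midpoint_convex_on_def)
  then show ?thesis
    unfolding approximable_def by (intro allI impI bexI[of _ "\<lambda>x\<in>K. c"]) auto
qed

lemma approximable_add:
  assumes "approximable K (A \<inter> convex_functions K) f" "approximable K (A \<inter> convex_functions K) g"
  shows "approximable K (A \<inter> convex_functions K) (\<lambda>x. f x + g x)"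
  unfolding approximable_def
proof (intro allI impI)
  fix e :: real assume "e > 0"
  then obtain u v where uv: "u \<in> A \<inter> convex_functions K" "v \<in> A \<inter> convex_functions K"
      "\<forall>x\<in>K. \<bar>f x - u x\<bar> \<le> e / 2" "\<forall>x\<in>K. \<bar>g x - v x\<bar> \<le> e / 2"
    using assms unfolding approximable_def by (meson half_gt_zero)
  have "midpoint_convex_on K (\<lambda>x. u x + v x)"
    using uv(1,2) by (fastforce simp: convex_functions_def midpoint_convex_on_def field_simps)
  then have "(\<lambda>x\<in>K. u x + v x) \<in> A \<inter> convex_functions K"
    using uv(1,2) algebra_add[OF A, of u v] convex_functionsD[OF K(1)]
    by (auto simp: restrict_mem_convex_functions[OF K] intro!: continuous_on_add)
  moreover have "\<bar>f x + g x - (\<lambda>x\<in>K. u x + v x) x\<bar> \<le> e" if "x \<in> K" for x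
    using uv(3)[rule_format, OF that] uv(4)[rule_format, OF that] unfolding restrict_apply'[OF that]
    by argo
  ultimately show "\<exists>h\<in>A \<inter> convex_functions K. \<forall>x\<in>K. \<bar>f x + g x - h x\<bar> \<le> e" by blast
qed

lemma approximable_scale:
  assumes "approximable K (A \<inter> convex_functions K) f" "0 \<le> c"
  shows "approximable K (A \<inter> convex_functions K) (\<lambda>x. c * f x)"
  unfolding approximable_def
proof (intro allI impI)
  fix e :: real assume e: "e > 0"
  with assms obtain u where u: "u \<in> A \<inter> convex_functions K" "\<forall>x\<in>K. \<bar>f x - u x\<bar> \<le> e / (1 + c)"
    unfolding approximable_def by (metis add_pos_nonneg divide_pos_pos zero_less_one)
  have "midpoint_convex_on K (\<lambda>x. c * u x)"
    unfolding midpoint_convex_on_def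
  proof (intro ballI)
    fix x y assume "x \<in> K" "y \<in> K"
    then have "c * u (midpoint x y) \<le> c * ((u x + u y) / 2)"
      using u(1) assms(2) by (intro mult_left_mono) (auto simp: convex_functions_def midpoint_convex_on_def)
    then show "c * u (midpoint x y) \<le> (c * u x + c * u y) / 2" by (simp add: algebra_simps)
  qed
  then have "(\<lambda>x\<in>K. c * u x) \<in> A \<inter> convex_functions K"
    using u(1) algebra_scale[OF A, of u] convex_functionsD[OF K(1)]
    by (auto simp: restrict_mem_convex_functions[OF K] intro!: continuous_on_mult_left)
  moreover have "\<bar>c * f x - (\<lambda>x\<in>K. c * u x) x\<bar> \<le> e" if "x \<in> K" for x
  proof -
    have "\<bar>c * f x - (\<lambda>x\<in>K. c * u x) x\<bar> = c * \<bar>f x - u x\<bar>"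
      using that assms(2) by (simp add: abs_mult flip: right_diff_distrib)
    also have "\<dots> \<le> (1 + c) * (e / (1 + c))"
      using u(2) that assms(2) by (intro mult_mono) auto
    finally show ?thesis using assms(2) by simp
  qed
  ultimately show "\<exists>h\<in>A \<inter> convex_functions K. \<forall>x\<in>K. \<bar>c * f x - h x\<bar> \<le> e" by blast
qed

lemma approximable_sum:
  assumes "finite I" "\<And>i. i \<in> I \<Longrightarrow> approximable K (A \<inter> convex_functions K) (f i)"
  shows "approximable K (A \<inter> convex_functions K) (\<lambda>x. \<Sum>i\<in>I. f i x)"
  using assms by (induction I rule: finite_induct) (auto intro: approximable_const approximable_add)

text \<open>
  The polynomial \<open>P(s, t) = (s + t + q (s - t)) / 2\<close> with \<open>q\<close> convex and 1-Lipschitz is convex, and it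
  is nondecreasing in \<open>s\<close> and in \<open>t\<close>. So \<open>P(u, v)\<close> is convex for convex \<open>u\<close> and \<open>v\<close>, and it lies in the
  algebra with them; it is close to \<open>max u v\<close> when \<open>q\<close> is close to the absolute value.
\<close>
lemma approximable_max:
  assumes "approximable K (A \<inter> convex_functions K) f" "approximable K (A \<inter> convex_functions K) g"
  shows "approximable K (A \<inter> convex_functions K) (\<lambda>x. max (f x) (g x))"
  unfolding approximable_def
proof (intro allI impI)
  fix e :: real assume e: "e > 0"
  then obtain u where "u \<in> A \<inter> convex_functions K" "\<forall>x\<in>K. \<bar>f x - u x\<bar> \<le> e / 2"
    using assms(1) unfolding approximable_def by (meson half_gt_zero)
  moreover obtain v where "v \<in> A \<inter> convex_functions K" "\<forall>x\<in>K. \<bar>g x - v x\<bar> \<le> e / 2"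
    using assms(2) e unfolding approximable_def by (meson half_gt_zero)
  ultimately have uv: "u \<in> A" "u \<in> convex_functions K" "v \<in> A" "v \<in> convex_functions K"
      "\<forall>x\<in>K. \<bar>f x - u x\<bar> \<le> e / 2" "\<forall>x\<in>K. \<bar>g x - v x\<bar> \<le> e / 2"
    by auto
  note u = convex_functionsD[OF K(1) uv(2)] and v = convex_functionsD[OF K(1) uv(4)]
  define w where "w x = u x - v x" for x
  have w_cont: "continuous_on K w" unfolding w_def by (intro continuous_intros u v)
  obtain B where B: "\<forall>x\<in>K. norm (u x) \<le> B" "\<forall>x\<in>K. norm (v x) \<le> B" "B > 0"
  proof -
    have "bounded (u ` K \<union> v ` K)"
      using K(1) u(1) v(1) by (simp add: compact_continuous_image compact_imp_bounded)
    then show thesis using that by (auto simp: bounded_pos)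
  qed
  define R where "R = 2 * B"
  obtain q where q: "real_polynomial_function q" "convex_on {-R..R} q"
    "\<And>s t. s \<in> {-R..R} \<Longrightarrow> t \<in> {-R..R} \<Longrightarrow> \<bar>q s - q t\<bar> \<le> \<bar>s - t\<bar>"
    "\<And>t. t \<in> {-R..R} \<Longrightarrow> \<bar>q t - \<bar>t\<bar>\<bar> \<le> e"
    using convex_polynomial_near_abs[of R e] B(3) e by (auto simp: R_def)
  have w_R: "w x \<in> {-R..R}" if "x \<in> K" for x
    using B(1)[rule_format, OF that] B(2)[rule_format, OF that]
    unfolding w_def R_def real_norm_def atLeastAtMost_iff by linarith
  define h where "h x = (u x + v x + q (w x)) / 2" for x
  have "midpoint_convex_on K h"
    unfolding midpoint_convex_on_def
  proof (intro ballI)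
    fix x y assume xy: "x \<in> K" "y \<in> K"
    let ?m = "midpoint x y" and ?s = "(u x + u y) / 2" and ?t = "(v x + v y) / 2"
    have m: "?m \<in> K" by (rule midpoint_mem_convex[OF K(2) xy])
    have s: "u ?m \<le> ?s" and t: "v ?m \<le> ?t"
      using u(2) v(2) xy by (auto simp: midpoint_convex_on_def)
    have st: "?s - ?t = (w x + w y) / 2" by (simp add: w_def field_simps)
    have st_R: "?s - ?t \<in> {-R..R}"
      using w_R[OF xy(1)] w_R[OF xy(2)] unfolding st by auto
    \<comment> \<open>Convexity of \<open>q\<close> compares the average with the value at \<open>?s - ?t\<close>; the Lipschitz bound then
      compares this with the value at the midpoint, at a cost paid by the linear part.\<close>
    have "q (?s - ?t) \<le> (q (w x) + q (w y)) / 2"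
      using convex_onD[OF q(2), of "1/2" "w x" "w y"] w_R[OF xy(1)] w_R[OF xy(2)] unfolding st
      by (simp add: add_divide_distrib)
    moreover have "\<bar>q (w ?m) - q (?s - ?t)\<bar> \<le> \<bar>w ?m - (?s - ?t)\<bar>"
      by (intro q(3) w_R m st_R)
    ultimately show "h ?m \<le> (h x + h y) / 2"
      using s t unfolding h_def w_def by argo
  qed
  moreover have "continuous_on K h"
    unfolding h_def using continuous_on_polymonial_function[of q "w ` K"] q(1)
    by (intro continuous_intros u v continuous_on_compose2[OF _ w_cont])
       (auto simp: real_polynomial_function_eq)
  moreover have "(\<lambda>x\<in>K. h x) \<in> A"
  proof -
    have "(\<lambda>x\<in>K. u x + (-1) * v x) \<in> A"
      using algebra_add[OF A uv(1) algebra_scale[OF A uv(3), of "-1"]] by (simp cong: restrict_cong)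
    from algebra_polynomial[OF A q(1) this]
    have "(\<lambda>x\<in>K. q (w x)) \<in> A" by (simp add: w_def cong: restrict_cong)
    from algebra_scale[OF A algebra_add[OF A algebra_add[OF A uv(1) uv(3)] this], of "1 / 2"]
    show ?thesis by (simp add: h_def cong: restrict_cong)
  qed
  moreover have "\<bar>max (f x) (g x) - (\<lambda>x\<in>K. h x) x\<bar> \<le> e" if x: "x \<in> K" for x
  proof -
    have "\<bar>max (u x) (v x) - h x\<bar> \<le> e / 2"
    proof -
      have "max (u x) (v x) = (u x + v x + \<bar>w x\<bar>) / 2" by (simp add: w_def max_def)
      then show ?thesis using q(4)[OF w_R[OF x]] unfolding h_def by argo
    qed
    moreover have "\<bar>f x - u x\<bar> \<le> e / 2" "\<bar>g x - v x\<bar> \<le> e / 2" using uv(5,6) x by auto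
    ultimately show ?thesis unfolding restrict_apply'[OF x] by linarith
  qed
  ultimately show "\<exists>h\<in>A \<inter> convex_functions K. \<forall>x\<in>K. \<bar>max (f x) (g x) - h x\<bar> \<le> e"
    using restrict_mem_convex_functions[OF K, of h] by blast
qed

lemma approximable_Max:
  assumes "finite I" "I \<noteq> {}" "\<And>i. i \<in> I \<Longrightarrow> approximable K (A \<inter> convex_functions K) (f i)"
  shows "approximable K (A \<inter> convex_functions K) (\<lambda>x. Max ((\<lambda>i. f i x) ` I))"
  using assms
proof (induction I rule: finite_ne_induct)
  case (insert i I)
  then show ?case using approximable_max[of "f i" "\<lambda>x. Max ((\<lambda>i. f i x) ` I)"] by simp
qed simp

end

section \<open>The coordinates and their negative sum generate the convex functions\<close>

text \<open>
  Here \<open>c \<ge> - a $ j\<close> for all \<open>j\<close>, so in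
  \<open>a \<bullet> x = (\<Sum>j. (a $ j + c) * x $ j) + c * (- (\<Sum>j. x $ j))\<close> all coefficients are nonnegative.
\<close>
lemma approximable_affine:
  fixes K :: "(real ^ 'n::finite) set"
  assumes K: "compact K" "convex K" and A: "unital_algebra K A"
    and coord: "\<And>j. approximable K (A \<inter> convex_functions K) (\<lambda>x. x $ j)"
    and neg: "approximable K (A \<inter> convex_functions K) (\<lambda>x. - (\<Sum>j\<in>UNIV. x $ j))"
  shows "approximable K (A \<inter> convex_functions K) (\<lambda>x. a \<bullet> x + b)"
proof -
  define c where "c = (\<Sum>j\<in>UNIV. \<bar>a $ j\<bar>)"
  have c: "0 \<le> a $ j + c" for j
    using member_le_sum[of j UNIV "\<lambda>j. \<bar>a $ j\<bar>"] by (simp add: c_def)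
  have "(\<lambda>x. a \<bullet> x + b) = (\<lambda>x. (\<Sum>j\<in>UNIV. (a $ j + c) * x $ j) + c * - (\<Sum>j\<in>UNIV. x $ j) + b)"
    by (simp add: inner_vec_def ring_distribs sum.distrib sum_distrib_left)
  moreover have "0 \<le> c" by (simp add: c_def sum_nonneg)
  ultimately show ?thesis using c
    by (simp only:) (intro approximable_add[OF K A] approximable_const[OF K A] approximable_scale[OF K A]
        approximable_sum[OF K A] coord neg finite)
qed

lemma coordinates_SG_set:
  fixes K :: "(real ^ 'n::finite) set"
  assumes K: "compact K" "convex K"
  shows "SG_set K (convex_functions K) (insert (neg_coord_sum K) (range (coord_fun K)))"
  unfolding SG_set_def
proof (intro conjI allI impI)
  have "neg_coord_sum K \<in> convex_functions K" "coord_fun K j \<in> convex_functions K" for j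
    unfolding neg_coord_sum_def coord_fun_def restrict_mem_convex_functions[OF K]
    by (auto simp: midpoint_convex_on_def midpoint_def sum.distrib sum_distrib_left field_simps
        simp flip: sum_divide_distrib intro!: continuous_intros)
  then show "insert (neg_coord_sum K) (range (coord_fun K)) \<subseteq> unif_closure K (convex_functions K)"
    by (auto simp: unif_closure_convex_functions[OF K])
next
  fix A assume A: "unital_algebra K A"
    and D: "insert (neg_coord_sum K) (range (coord_fun K)) \<subseteq> unif_closure K (A \<inter> convex_functions K)"
  have "approximable K (A \<inter> convex_functions K) f"
    if "f \<in> insert (neg_coord_sum K) (range (coord_fun K))" for f
    using D that mem_unif_closure_algebra_convex[OF K(1), of f A] by blast
  then have "approximable K (A \<inter> convex_functions K) (coord_fun K j)"
    "approximable K (A \<inter> convex_functions K) (neg_coord_sum K)" for j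
    by blast+
  then have affine: "approximable K (A \<inter> convex_functions K) (\<lambda>x. a \<bullet> x + b)" for a b
    by (intro approximable_affine[OF K A]) (auto simp: approximable_def coord_fun_def neg_coord_sum_def)
  show "convex_functions K \<subseteq> unif_closure K (A \<inter> convex_functions K)"
  proof
    fix f assume f: "f \<in> convex_functions K"
    have "approximable K (A \<inter> convex_functions K) f"
    proof (cases "K = {}")
      case True
      then show ?thesis using approximable_const[OF K A] by (simp add: approximable_def)
    next
      case False
      note f' = convex_functionsD[OF K(1) f]
      show ?thesis unfolding approximable_def
      proof (intro allI impI)
        fix e :: real assume "e > 0"
        then obtain I where I: "finite I" "I \<noteq> {}"
            "\<And>x. x \<in> K \<Longrightarrow> \<bar>f x - Max ((\<lambda>(a, b). a \<bullet> x + b) ` I)\<bar> \<le> e / 2"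
          using convex_function_finite_affine_max[OF K(1) False
              midpoint_convex_imp_convex_on[OF K(2) f'] f'(1), of "e / 2"] by auto
        have "approximable K (A \<inter> convex_functions K) (\<lambda>x. Max ((\<lambda>i. fst i \<bullet> x + snd i) ` I))"
          by (intro approximable_Max[OF K A] I affine)
        then obtain g where g: "g \<in> A \<inter> convex_functions K"
            "\<forall>x\<in>K. \<bar>Max ((\<lambda>i. fst i \<bullet> x + snd i) ` I) - g x\<bar> \<le> e / 2"
          using \<open>e > 0\<close> unfolding approximable_def by (meson half_gt_zero)
        have "\<bar>f x - g x\<bar> \<le> e" if "x \<in> K" for x
          using I(3)[OF that] g(2)[rule_format, OF that] unfolding case_prod_beta by argo
        with g(1) show "\<exists>g\<in>A \<inter> convex_functions K. \<forall>x\<in>K. \<bar>f x - g x\<bar> \<le> e" by blast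
      qed
    qed
    moreover have "f \<in> C_space K" using f by (simp add: convex_functions_def)
    ultimately show "f \<in> unif_closure K (A \<inter> convex_functions K)"
      by (simp add: mem_unif_closure_algebra_convex[OF K(1)])
  qed
qed

section \<open>A point derivation that is nonnegative on convex functions\<close>

text \<open>
  The expansion \<open>\<phi> t = \<phi> 0 + b t + b \<bar>t\<bar>\<^bsup>3/2\<^esup> + o(\<bar>t\<bar>\<^bsup>3/2\<^esup>)\<close> at \<open>0\<close>. The same coefficient \<open>b\<close> occurs twice:
  the even term of order \<open>3/2\<close> ties the sign of the slope to that of the second difference.
\<close>
definition cusp :: "(real \<Rightarrow> real) \<Rightarrow> real \<Rightarrow> bool" where
  "cusp \<phi> b \<longleftrightarrow> ((\<lambda>t. (\<phi> t - \<phi> 0 - b * t) / (\<bar>t\<bar> * sqrt \<bar>t\<bar>)) \<longlongrightarrow> b) (at 0)"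

lemma cusp_cong:
  assumes "eventually (\<lambda>t. \<phi> t = \<psi> t) (nhds 0)"
  shows "cusp \<phi> b \<longleftrightarrow> cusp \<psi> b"
proof -
  have "\<phi> 0 = \<psi> 0" using assms by (rule eventually_nhds_x_imp_x)
  moreover have "eventually (\<lambda>t. \<phi> t = \<psi> t) (at 0)"
    using assms by (simp add: eventually_nhds_conv_at)
  ultimately show ?thesis
    unfolding cusp_def by (intro tendsto_cong) (auto elim: eventually_mono)
qed

lemma cusp_const: "cusp (\<lambda>_. c) 0"
  by (simp add: cusp_def)

lemma cusp_add:
  assumes "cusp \<phi> a" "cusp \<psi> b"
  shows "cusp (\<lambda>t. \<phi> t + \<psi> t) (a + b)"
  using tendsto_add[OF assms[unfolded cusp_def]] unfolding cusp_def
  by (simp add: add_divide_distrib[symmetric] algebra_simps)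

lemma cusp_scale:
  assumes "cusp \<phi> a"
  shows "cusp (\<lambda>t. c * \<phi> t) (c * a)"
  using tendsto_mult_left[OF assms[unfolded cusp_def], of c] unfolding cusp_def
  by (simp add: algebra_simps)

lemma cusp_slope:
  assumes "cusp \<phi> b"
  shows "((\<lambda>t. (\<phi> t - \<phi> 0) / t) \<longlongrightarrow> b) (at 0)"
proof -
  have "((\<lambda>t. \<bar>sqrt \<bar>t\<bar>\<bar>) \<longlongrightarrow> 0) (at (0::real))"
    by (auto intro!: tendsto_eq_intros)
  then have "((\<lambda>t. sgn t * sqrt \<bar>t\<bar>) \<longlongrightarrow> 0) (at (0::real))"
    by (rule tendsto_0_le[where K = 1]) (auto simp: abs_mult abs_sgn_eq)
  from tendsto_add[OF tendsto_const tendsto_mult[OF assms[unfolded cusp_def] this], of b]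
  have "((\<lambda>t. b + (\<phi> t - \<phi> 0 - b * t) / (\<bar>t\<bar> * sqrt \<bar>t\<bar>) * (sgn t * sqrt \<bar>t\<bar>)) \<longlongrightarrow> b) (at 0)"
    by simp
  then show ?thesis
  proof (rule Lim_transform_eventually)
    show "eventually (\<lambda>t. b + (\<phi> t - \<phi> 0 - b * t) / (\<bar>t\<bar> * sqrt \<bar>t\<bar>) * (sgn t * sqrt \<bar>t\<bar>)
        = (\<phi> t - \<phi> 0) / t) (at 0)"
      unfolding eventually_at_filter
      by (intro always_eventually) (auto simp: field_simps sgn_if abs_if)
  qed
qed

text \<open>
  Write \<open>\<phi>\<psi> - \<phi>(0)\<psi>(0)\<close> as \<open>\<phi>(0)(\<psi> - \<psi>(0)) + \<psi>(0)(\<phi> - \<phi>(0))\<close> plus the product of the two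
  increments. This product has order \<open>t\<^sup>2\<close> and is therefore negligible at order \<open>3/2\<close>.
\<close>
lemma cusp_mult:
  assumes "cusp \<phi> a" "cusp \<psi> b"
  shows "cusp (\<lambda>t. \<phi> t * \<psi> t) (\<phi> 0 * b + \<psi> 0 * a)"
proof -
  have "((\<lambda>t. sqrt \<bar>t\<bar>) \<longlongrightarrow> 0) (at (0::real))"
    by (auto intro!: tendsto_eq_intros)
  from tendsto_mult[OF tendsto_mult[OF cusp_slope[OF assms(1)] cusp_slope[OF assms(2)]] this]
  have "((\<lambda>t. (\<phi> t - \<phi> 0) / t * ((\<psi> t - \<psi> 0) / t) * sqrt \<bar>t\<bar>) \<longlongrightarrow> 0) (at 0)"
    by simp
  from tendsto_add[OF tendsto_add[OF tendsto_mult_left[OF assms(2)[unfolded cusp_def], of "\<phi> 0"]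
        tendsto_mult_left[OF assms(1)[unfolded cusp_def], of "\<psi> 0"]] this]
  have "((\<lambda>t. \<phi> 0 * ((\<psi> t - \<psi> 0 - b * t) / (\<bar>t\<bar> * sqrt \<bar>t\<bar>))
      + \<psi> 0 * ((\<phi> t - \<phi> 0 - a * t) / (\<bar>t\<bar> * sqrt \<bar>t\<bar>))
      + (\<phi> t - \<phi> 0) / t * ((\<psi> t - \<psi> 0) / t) * sqrt \<bar>t\<bar>) \<longlongrightarrow> \<phi> 0 * b + \<psi> 0 * a) (at 0)"
    by simp
  then show ?thesis unfolding cusp_def
  proof (rule Lim_transform_eventually)
    have "\<phi> 0 * ((\<psi> t - \<psi> 0 - b * t) / (\<bar>t\<bar> * sqrt \<bar>t\<bar>))
        + \<psi> 0 * ((\<phi> t - \<phi> 0 - a * t) / (\<bar>t\<bar> * sqrt \<bar>t\<bar>))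
        + (\<phi> t - \<phi> 0) / t * ((\<psi> t - \<psi> 0) / t) * sqrt \<bar>t\<bar>
        = (\<phi> t * \<psi> t - \<phi> 0 * \<psi> 0 - (\<phi> 0 * b + \<psi> 0 * a) * t) / (\<bar>t\<bar> * sqrt \<bar>t\<bar>)" if t: "t \<noteq> 0" for t
    proof -
      have "sqrt \<bar>t\<bar> * (\<bar>t\<bar> * sqrt \<bar>t\<bar>) = (sqrt \<bar>t\<bar>)\<^sup>2 * \<bar>t\<bar>"
        by (simp only: power2_eq_square mult_ac)
      also have "\<dots> = t * t" by simp
      finally have "sqrt \<bar>t\<bar> * (\<bar>t\<bar> * sqrt \<bar>t\<bar>) = t * t" .
      then have "(\<phi> t - \<phi> 0) / t * ((\<psi> t - \<psi> 0) / t) * sqrt \<bar>t\<bar>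
          = (\<phi> t - \<phi> 0) * (\<psi> t - \<psi> 0) / (\<bar>t\<bar> * sqrt \<bar>t\<bar>)"
        using t by (simp add: divide_simps)
      then show ?thesis by (simp add: add_divide_distrib[symmetric] algebra_simps)
    qed
    then show "eventually (\<lambda>t. \<phi> 0 * ((\<psi> t - \<psi> 0 - b * t) / (\<bar>t\<bar> * sqrt \<bar>t\<bar>))
        + \<psi> 0 * ((\<phi> t - \<phi> 0 - a * t) / (\<bar>t\<bar> * sqrt \<bar>t\<bar>))
        + (\<phi> t - \<phi> 0) / t * ((\<psi> t - \<psi> 0) / t) * sqrt \<bar>t\<bar>
        = (\<phi> t * \<psi> t - \<phi> 0 * \<psi> 0 - (\<phi> 0 * b + \<psi> 0 * a) * t) / (\<bar>t\<bar> * sqrt \<bar>t\<bar>)) (at 0)"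
      unfolding eventually_at_filter by (intro always_eventually) auto
  qed
qed

lemma line_eventually_in_interior:
  fixes x0 w :: "'a::real_normed_vector"
  assumes "x0 \<in> interior K"
  shows "eventually (\<lambda>t. x0 + t *\<^sub>R w \<in> K) (nhds (0::real))"
proof -
  have "((\<lambda>t::real. x0 + t *\<^sub>R w) \<longlongrightarrow> x0 + 0 *\<^sub>R w) (nhds 0)"
    by (rule tendsto_add[OF tendsto_const tendsto_scaleR[OF filterlim_ident tendsto_const]])
  then have "eventually (\<lambda>t::real. x0 + t *\<^sub>R w \<in> interior K) (nhds 0)"
    using assms by (intro topological_tendstoD) auto
  then show ?thesis
    by (rule eventually_mono) (use interior_subset in blast)
qed

definition cusp_algebra :: "'a::real_normed_vector set \<Rightarrow> 'a \<Rightarrow> 'a \<Rightarrow> ('a \<Rightarrow> real) set" where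
  "cusp_algebra K x0 w = {h \<in> C_space K. \<exists>b. cusp (\<lambda>t. h (x0 + t *\<^sub>R w)) b}"

lemma cusp_restrict:
  fixes x0 w :: "'a::real_normed_vector"
  assumes "x0 \<in> interior K"
  shows "cusp (\<lambda>t. (\<lambda>x\<in>K. h x) (x0 + t *\<^sub>R w)) b \<longleftrightarrow> cusp (\<lambda>t. h (x0 + t *\<^sub>R w)) b"
  by (rule cusp_cong) (use line_eventually_in_interior[OF assms, of w] in \<open>auto elim: eventually_mono\<close>)

lemma unital_algebra_cusp_algebra:
  assumes "compact K" and x0: "x0 \<in> interior K"
  shows "unital_algebra K (cusp_algebra K x0 w)"
proof -
  have C: "(\<lambda>x\<in>K. f x) \<in> C_space K" if "continuous_on K f" for f :: "'a \<Rightarrow> real"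
    using that by (simp add: C_space_compact[OF assms(1)] cong: continuous_on_cong)
  have D: "continuous_on K f" if "f \<in> C_space K" for f :: "'a \<Rightarrow> real"
    using that by (simp add: C_space_compact[OF assms(1)])
  show ?thesis
    unfolding unital_algebra_def
  proof (intro conjI ballI allI)
    fix f g and c :: real assume "f \<in> cusp_algebra K x0 w" "g \<in> cusp_algebra K x0 w"
    then obtain a b where f: "continuous_on K f" "cusp (\<lambda>t. f (x0 + t *\<^sub>R w)) a"
        and g: "continuous_on K g" "cusp (\<lambda>t. g (x0 + t *\<^sub>R w)) b"
      unfolding cusp_algebra_def using D by blast
    show "(\<lambda>x\<in>K. f x + g x) \<in> cusp_algebra K x0 w"
      using C[OF continuous_on_add[OF f(1) g(1)]] cusp_add[OF f(2) g(2)]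
      unfolding cusp_algebra_def mem_Collect_eq cusp_restrict[OF x0] by blast
    show "(\<lambda>x\<in>K. c * f x) \<in> cusp_algebra K x0 w"
      using C[OF continuous_on_mult_left[OF f(1)]] cusp_scale[OF f(2)]
      unfolding cusp_algebra_def mem_Collect_eq cusp_restrict[OF x0] by blast
    show "(\<lambda>x\<in>K. f x * g x) \<in> cusp_algebra K x0 w"
      using C[OF continuous_on_mult[OF f(1) g(1)]] cusp_mult[OF f(2) g(2)]
      unfolding cusp_algebra_def mem_Collect_eq cusp_restrict[OF x0] by blast
  next
    show "(\<lambda>x\<in>K. 1) \<in> cusp_algebra K x0 w"
      using C[OF continuous_on_const] cusp_const
      unfolding cusp_algebra_def mem_Collect_eq cusp_restrict[OF x0] by blast
  qed (simp add: cusp_algebra_def)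
qed

text \<open>
  Adding the expansions at \<open>t\<close> and \<open>-t\<close> cancels the odd terms and leaves \<open>2 b \<bar>t\<bar>\<^bsup>3/2\<^esup>\<close> as the leading
  term of the second difference.
\<close>
lemma convex_cusp_nonneg:
  fixes x0 w :: "'a::real_normed_vector"
  assumes f: "convex_on K f" and x0: "x0 \<in> interior K" and b: "cusp (\<lambda>t. f (x0 + t *\<^sub>R w)) b"
  shows "0 \<le> b"
proof -
  define \<phi> where "\<phi> t = f (x0 + t *\<^sub>R w)" for t
  define E where "E t = (\<phi> t - \<phi> 0 - b * t) / (\<bar>t\<bar> * sqrt \<bar>t\<bar>)" for t
  have E: "(E \<longlongrightarrow> b) (at 0)" using b by (simp add: cusp_def \<phi>_def E_def[abs_def])
  have "filterlim uminus (at 0) (at (0::real))"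
    by (auto simp: filterlim_at eventually_at_filter intro!: tendsto_eq_intros)
  from tendsto_add[OF E filterlim_compose[OF E this]]
  have lim: "((\<lambda>t. E t + E (- t)) \<longlongrightarrow> b + b) (at 0)" .
  have "0 \<le> b + b"
  proof (rule tendsto_lowerbound[OF lim])
    have "eventually (\<lambda>t. x0 + t *\<^sub>R w \<in> K \<and> x0 + t *\<^sub>R (- w) \<in> K) (at (0::real))"
      using line_eventually_in_interior[OF x0, of w] line_eventually_in_interior[OF x0, of "- w"]
      by (simp add: eventually_nhds_conv_at eventually_conj)
    then show "eventually (\<lambda>t. 0 \<le> E t + E (- t)) (at 0)"
    proof (rule eventually_mono)
      fix t :: real assume t: "x0 + t *\<^sub>R w \<in> K \<and> x0 + t *\<^sub>R (- w) \<in> K"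
      have "(1 - 1/2) *\<^sub>R (x0 + t *\<^sub>R w) + (1/2) *\<^sub>R (x0 + t *\<^sub>R (- w)) = x0"
        by (simp add: algebra_simps flip: scaleR_left_distrib)
      then have "\<phi> 0 \<le> (\<phi> t + \<phi> (- t)) / 2"
        using convex_onD[OF f, of "1/2" "x0 + t *\<^sub>R w" "x0 + t *\<^sub>R (- w)"] t
        by (simp add: \<phi>_def add_divide_distrib)
      then have "0 \<le> (\<phi> t - \<phi> 0 - b * t) + (\<phi> (- t) - \<phi> 0 - b * (- t))" by argo
      then show "0 \<le> E t + E (- t)"
        unfolding E_def by (simp flip: add_divide_distrib)
    qed
  qed simp
  then show ?thesis by simp
qed

lemma convex_cusp_increasing:
  fixes x0 w :: "'a::real_normed_vector"
  assumes f: "convex_on K f" and x0: "x0 \<in> interior K" and b: "cusp (\<lambda>t. f (x0 + t *\<^sub>R w)) b"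
    and r: "0 < r" "x0 + r *\<^sub>R w \<in> K"
  shows "f x0 \<le> f (x0 + r *\<^sub>R w)"
proof -
  define \<phi> where "\<phi> t = f (x0 + t *\<^sub>R w)" for t
  have "((\<lambda>t. (\<phi> t - \<phi> 0) / t) \<longlongrightarrow> b) (at_right 0)"
    using cusp_slope[OF b] unfolding \<phi>_def by (rule Lim_at_imp_Lim_at_within)
  then have "b \<le> (\<phi> r - \<phi> 0) / r"
  proof (rule tendsto_upperbound)
    show "eventually (\<lambda>t. (\<phi> t - \<phi> 0) / t \<le> (\<phi> r - \<phi> 0) / r) (at_right 0)"
    proof (rule eventually_at_rightI[OF _ r(1)])
      fix t assume t: "t \<in> {0<..<r}"
      have "(1 - t / r) *\<^sub>R x0 + (t / r) *\<^sub>R (x0 + r *\<^sub>R w) = x0 + t *\<^sub>R w"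
        using r(1) by (simp add: algebra_simps)
      then have "\<phi> t \<le> (1 - t / r) * \<phi> 0 + t / r * \<phi> r"
        using convex_onD[OF f, of "t / r" x0 "x0 + r *\<^sub>R w"] t r x0 interior_subset[of K]
        by (auto simp: \<phi>_def)
      then show "(\<phi> t - \<phi> 0) / t \<le> (\<phi> r - \<phi> 0) / r"
        using t r(1) by (simp add: field_simps)
    qed
  qed simp
  moreover have "0 \<le> b" by (rule convex_cusp_nonneg[OF f x0 b])
  ultimately have "0 \<le> (\<phi> r - \<phi> 0) / r" by linarith
  then show ?thesis using r(1) by (simp add: \<phi>_def zero_le_divide_iff)
qed

section \<open>Convex functions with a prescribed cusp\<close>

text \<open>
  This is \<open>\<bar>t\<bar>\<^bsup>3/2\<^esup>\<close> for \<open>\<bar>t\<bar> \<le> \<kappa>\<^sup>2\<close>, continued by its tangent lines of slope \<open>\<plusminus> 3 \<kappa> / 2\<close>. Thus it has the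
  required germ at \<open>0\<close>, but is as small as desired on bounded sets. With \<open>\<sigma>\<close> running over \<open>[0, \<kappa>]\<close>
  the lines \<open>(3 \<sigma> \<bar>t\<bar> - \<sigma>\<^sup>3) / 2\<close> are tangent to \<open>\<bar>t\<bar>\<^bsup>3/2\<^esup>\<close> at \<open>\<bar>t\<bar> = \<sigma>\<^sup>2\<close>, and the function is their
  maximum.
\<close>
definition cusp_fun :: "real \<Rightarrow> real \<Rightarrow> real" where
  "cusp_fun \<kappa> t = (let \<sigma> = min (sqrt \<bar>t\<bar>) \<kappa> in (3 * \<sigma> * \<bar>t\<bar> - \<sigma> ^ 3) / 2)"

text \<open>
  With \<open>\<bar>t\<bar> = s\<^sup>2\<close> the difference of the two sides factors, in either case of the definition, into
  nonnegative terms. Convexity follows: at a midpoint the function agrees with one of the tangents.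
\<close>
lemma cusp_fun_ge_tangent:
  assumes "0 \<le> c" "c \<le> \<kappa>"
  shows "(3 * c * \<bar>t\<bar> - c ^ 3) / 2 \<le> cusp_fun \<kappa> t"
proof -
  define s where "s = sqrt \<bar>t\<bar>"
  have s: "0 \<le> s" "\<bar>t\<bar> = s\<^sup>2" by (simp_all add: s_def)
  show ?thesis
  proof (cases "s \<le> \<kappa>")
    case True
    have "0 \<le> (s - c)\<^sup>2 * (2 * s + c)" using s assms by simp
    also have "\<dots> = (3 * s * s\<^sup>2 - s ^ 3) - (3 * c * s\<^sup>2 - c ^ 3)"
      by (simp add: power2_eq_square power3_eq_cube algebra_simps)
    finally show ?thesis using True by (simp add: cusp_fun_def s flip: s_def)
  next
    case False
    have "\<kappa>\<^sup>2 \<le> s\<^sup>2" "\<kappa> * c \<le> s\<^sup>2" "c\<^sup>2 \<le> s\<^sup>2"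
      using False assms s(1) by (auto simp: power2_eq_square intro!: mult_mono)
    then have "0 \<le> (\<kappa> - c) * (3 * s\<^sup>2 - \<kappa>\<^sup>2 - \<kappa> * c - c\<^sup>2)"
      using assms by (intro mult_nonneg_nonneg) auto
    also have "\<dots> = (3 * \<kappa> * s\<^sup>2 - \<kappa> ^ 3) - (3 * c * s\<^sup>2 - c ^ 3)"
      by (simp add: power2_eq_square power3_eq_cube algebra_simps)
    finally show ?thesis using False by (simp add: cusp_fun_def s min_def flip: s_def)
  qed
qed

lemma cusp_fun_nonneg: "0 \<le> \<kappa> \<Longrightarrow> 0 \<le> cusp_fun \<kappa> t"
  using cusp_fun_ge_tangent[of 0 \<kappa> t] by simp

lemma cusp_fun_le:
  assumes "0 \<le> \<kappa>"
  shows "cusp_fun \<kappa> t \<le> 3 / 2 * \<kappa> * \<bar>t\<bar>"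
proof -
  define \<sigma> where "\<sigma> = min (sqrt \<bar>t\<bar>) \<kappa>"
  have "0 \<le> \<sigma>" "\<sigma> \<le> \<kappa>" using assms by (auto simp: \<sigma>_def)
  then have "\<sigma> * \<bar>t\<bar> \<le> \<kappa> * \<bar>t\<bar>" "0 \<le> \<sigma> ^ 3" by (auto intro: mult_right_mono)
  moreover have "cusp_fun \<kappa> t = (3 * (\<sigma> * \<bar>t\<bar>) - \<sigma> ^ 3) / 2"
    by (simp add: cusp_fun_def Let_def \<sigma>_def)
  moreover have "3 / 2 * \<kappa> * \<bar>t\<bar> = 3 / 2 * (\<kappa> * \<bar>t\<bar>)" by simp
  ultimately show ?thesis by argo
qed

lemma continuous_on_cusp_fun: "continuous_on S (cusp_fun \<kappa>)"
proof -
  have "cusp_fun \<kappa> = (\<lambda>t. (3 * min (sqrt \<bar>t\<bar>) \<kappa> * \<bar>t\<bar> - min (sqrt \<bar>t\<bar>) \<kappa> ^ 3) / 2)"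
    by (simp add: fun_eq_iff cusp_fun_def Let_def)
  then show ?thesis by (simp only:) (intro continuous_intros; simp)
qed

lemma cusp_fun_midpoint:
  assumes "0 \<le> \<kappa>"
  shows "cusp_fun \<kappa> ((s + t) / 2) \<le> (cusp_fun \<kappa> s + cusp_fun \<kappa> t) / 2"
proof -
  define \<sigma> where "\<sigma> = min (sqrt \<bar>(s + t) / 2\<bar>) \<kappa>"
  have \<sigma>: "0 \<le> \<sigma>" "\<sigma> \<le> \<kappa>" using assms by (auto simp: \<sigma>_def)
  have "\<bar>(s + t) / 2\<bar> \<le> (\<bar>s\<bar> + \<bar>t\<bar>) / 2" by argo
  then have "\<sigma> * \<bar>(s + t) / 2\<bar> \<le> \<sigma> * ((\<bar>s\<bar> + \<bar>t\<bar>) / 2)" using \<sigma>(1) by (rule mult_left_mono)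
  moreover have "cusp_fun \<kappa> ((s + t) / 2) = (3 * (\<sigma> * \<bar>(s + t) / 2\<bar>) - \<sigma> ^ 3) / 2"
    by (simp add: cusp_fun_def Let_def \<sigma>_def)
  ultimately show ?thesis
    using cusp_fun_ge_tangent[OF \<sigma>, of s] cusp_fun_ge_tangent[OF \<sigma>, of t]
    by (simp add: algebra_simps add_divide_distrib)
qed

lemma cusp_cusp_fun:
  assumes "0 < \<kappa>"
  shows "cusp (\<lambda>t. c + b * t + b * cusp_fun \<kappa> t) b"
proof -
  have "eventually (\<lambda>t. t \<in> {- \<kappa>\<^sup>2<..<\<kappa>\<^sup>2}) (nhds (0::real))"
    using assms by (intro eventually_nhds_in_open) auto
  then have "eventually (\<lambda>t. c + b * t + b * cusp_fun \<kappa> t = c + b * t + b * (\<bar>t\<bar> * sqrt \<bar>t\<bar>)) (nhds 0)"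
  proof (rule eventually_mono)
    fix t assume t: "t \<in> {- \<kappa>\<^sup>2<..<\<kappa>\<^sup>2}"
    then have "sqrt \<bar>t\<bar> \<le> \<kappa>" using assms by (intro real_le_lsqrt) auto
    then have "cusp_fun \<kappa> t = \<bar>t\<bar> * sqrt \<bar>t\<bar>"
      by (simp add: cusp_fun_def power3_eq_cube)
    then show "c + b * t + b * cusp_fun \<kappa> t = c + b * t + b * (\<bar>t\<bar> * sqrt \<bar>t\<bar>)" by simp
  qed
  then have "cusp (\<lambda>t. c + b * t + b * cusp_fun \<kappa> t) b \<longleftrightarrow> cusp (\<lambda>t. c + b * t + b * (\<bar>t\<bar> * sqrt \<bar>t\<bar>)) b"
    by (rule cusp_cong)
  also have "\<dots>"
    unfolding cusp_def
    by (rule Lim_transform_eventually[OF tendsto_const]) (auto simp: eventually_at_filter)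
  finally show ?thesis .
qed

text \<open>
  The function \<open>g\<close> lies above \<open>f\<close> at \<open>x\<^sub>0\<close> by \<open>e / 2\<close>, hence \<open>max f g\<close> equals \<open>g\<close> near \<open>x\<^sub>0\<close> and
  inherits its expansion along \<open>w\<close>; and \<open>g \<le> f + e\<close> on \<open>K\<close>, hence \<open>max f g\<close> is within \<open>e\<close> of \<open>f\<close>. The
  sign of \<open>b = v \<bullet> w\<close> is needed for the convexity of \<open>g\<close>.
\<close>
lemma approximable_cusp_algebra:
  fixes K :: "'a::euclidean_space set"
  assumes K: "compact K" "convex K" and x0: "x0 \<in> interior K"
    and f: "f \<in> convex_functions K"
    and v: "\<And>x. x \<in> K \<Longrightarrow> f x0 + v \<bullet> (x - x0) \<le> f x" and w: "w \<noteq> 0" "0 \<le> v \<bullet> w"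
  shows "approximable K (cusp_algebra K x0 w \<inter> convex_functions K) f"
  unfolding approximable_def
proof (intro allI impI)
  fix e :: real assume e: "e > 0"
  note f' = convex_functionsD[OF K(1) f]
  \<comment> \<open>The functional \<open>x \<mapsto> u \<bullet> (x - x\<^sub>0)\<close> reads off the parameter \<open>t\<close> on the line \<open>x\<^sub>0 + t w\<close>.\<close>
  define u where "u = (1 / (w \<bullet> w)) *\<^sub>R w"
  have uw: "u \<bullet> w = 1" using w(1) by (simp add: u_def)
  have "compact ((\<lambda>x. u \<bullet> (x - x0)) ` K)"
    by (intro compact_continuous_image continuous_intros K)
  then obtain T where T: "T > 0" "\<And>x. x \<in> K \<Longrightarrow> \<bar>u \<bullet> (x - x0)\<bar> \<le> T"
    by (auto dest!: compact_imp_bounded simp: bounded_pos)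
  define b where "b = v \<bullet> w"
  \<comment> \<open>The slope \<open>3 \<kappa> / 2\<close> keeps the added term below \<open>e / 2\<close>; \<open>b + 1\<close> avoids division by zero.\<close>
  define \<kappa> where "\<kappa> = e / (3 * (b + 1) * T)"
  have \<kappa>: "\<kappa> > 0" using e T(1) w(2) by (simp add: \<kappa>_def b_def)
  define g where "g x = f x0 + e / 2 + v \<bullet> (x - x0) + b * cusp_fun \<kappa> (u \<bullet> (x - x0))" for x
  define h where "h x = max (f x) (g x)" for x
  have g_le: "g x \<le> f x + e" if "x \<in> K" for x
  proof -
    have "cusp_fun \<kappa> (u \<bullet> (x - x0)) \<le> 3 / 2 * \<kappa> * \<bar>u \<bullet> (x - x0)\<bar>"
      using \<kappa> by (intro cusp_fun_le) simp
    also have "\<dots> \<le> 3 / 2 * \<kappa> * T" using \<kappa> T(2)[OF that] by (intro mult_left_mono) auto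
    finally have "b * cusp_fun \<kappa> (u \<bullet> (x - x0)) \<le> (b + 1) * (3 / 2 * \<kappa> * T)"
      using w(2) \<kappa> by (intro mult_mono) (auto simp: b_def cusp_fun_nonneg)
    also have "\<dots> = e / 2"
    proof -
      have "b + 1 \<noteq> 0" using w(2) by (simp add: b_def add_nonneg_eq_0_iff)
      then have "(b + 1) * (3 / 2 * \<kappa> * T) = 3 / 2 * (e / 3)"
        unfolding \<kappa>_def using T(1) by (simp add: divide_simps)
      then show ?thesis by simp
    qed
    finally show ?thesis using v[OF that] by (simp add: g_def)
  qed
  have g_mid: "g (midpoint x y) \<le> (g x + g y) / 2" for x y
  proof -
    have mid: "a \<bullet> (midpoint x y - x0) = (a \<bullet> (x - x0) + a \<bullet> (y - x0)) / 2" for a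
      by (simp add: midpoint_def inner_diff_right inner_add_right field_simps)
    have "b * cusp_fun \<kappa> (u \<bullet> (midpoint x y - x0))
        \<le> b * ((cusp_fun \<kappa> (u \<bullet> (x - x0)) + cusp_fun \<kappa> (u \<bullet> (y - x0))) / 2)"
      using w(2) \<kappa> unfolding mid by (intro mult_left_mono cusp_fun_midpoint) (auto simp: b_def)
    also have "\<dots> = (b * cusp_fun \<kappa> (u \<bullet> (x - x0)) + b * cusp_fun \<kappa> (u \<bullet> (y - x0))) / 2"
      by (simp add: distrib_left)
    finally show ?thesis unfolding g_def mid[of v] by argo
  qed
  have "continuous_on K g"
    unfolding g_def
    by (intro continuous_intros continuous_on_compose2[OF continuous_on_cusp_fun[of UNIV]]) auto
  then have h_cont: "continuous_on K h" unfolding h_def by (intro continuous_intros f')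
  have "midpoint_convex_on K h"
    unfolding midpoint_convex_on_def
  proof (intro ballI)
    fix x y assume xy: "x \<in> K" "y \<in> K"
    have "f (midpoint x y) \<le> (f x + f y) / 2" using f'(2) xy by (auto simp: midpoint_convex_on_def)
    moreover have "f x \<le> h x" "f y \<le> h y" "g x \<le> h x" "g y \<le> h y" by (auto simp: h_def)
    moreover note g_mid[of x y]
    ultimately have "f (midpoint x y) \<le> (h x + h y) / 2" "g (midpoint x y) \<le> (h x + h y) / 2"
      by argo+
    then show "h (midpoint x y) \<le> (h x + h y) / 2" by (simp add: h_def)
  qed
  with h_cont have h_convex: "(\<lambda>x\<in>K. h x) \<in> convex_functions K"
    by (simp add: restrict_mem_convex_functions[OF K])
  have "eventually (\<lambda>t. h (x0 + t *\<^sub>R w) = (f x0 + e / 2) + b * t + b * cusp_fun \<kappa> t) (nhds 0)"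
  proof -
    have line: "g (x0 + t *\<^sub>R w) = (f x0 + e / 2) + b * t + b * cusp_fun \<kappa> t" for t
      by (simp add: g_def uw b_def)
    have "continuous_on (interior K) (\<lambda>x. g x - f x)"
      using \<open>continuous_on K g\<close> f'(1) interior_subset 
      by (intro continuous_on_diff continuous_on_subset[of K _ "interior K"])
    then have "open (interior K \<inter> (\<lambda>x. g x - f x) -` {0<..})"
      by (rule continuous_open_preimage) auto
    moreover have "0 \<le> b * cusp_fun \<kappa> 0"
      using w(2) \<kappa> by (simp add: b_def cusp_fun_nonneg)
    then have "x0 \<in> interior K \<inter> (\<lambda>x. g x - f x) -` {0<..}"
      using x0 e by (simp add: g_def)
    moreover have "interior K \<inter> (\<lambda>x. g x - f x) -` {0<..} \<subseteq> {x. f x < g x}" by auto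
    ultimately have "x0 \<in> interior {x. f x < g x}" by (rule interiorI)
    from line_eventually_in_interior[OF this, of w] show ?thesis
      by (rule eventually_mono) (auto simp: h_def line)
  qed
  from cusp_cong[OF this] have "cusp (\<lambda>t. h (x0 + t *\<^sub>R w)) b"
    using cusp_cusp_fun[OF \<kappa>] by blast
  then have "(\<lambda>x\<in>K. h x) \<in> cusp_algebra K x0 w"
    unfolding cusp_algebra_def mem_Collect_eq cusp_restrict[OF x0]
    using h_convex by (auto simp: convex_functions_def)
  moreover have "\<bar>f x - (\<lambda>x\<in>K. h x) x\<bar> \<le> e" if "x \<in> K" for x
    using g_le[OF that] that e by (simp add: h_def)
  ultimately show "\<exists>h\<in>cusp_algebra K x0 w \<inter> convex_functions K. \<forall>x\<in>K. \<bar>f x - h x\<bar> \<le> e"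
    using h_convex by blast
qed

section \<open>Fewer functions do not suffice\<close>

text \<open>
  Either the vectors do not span and some \<open>w\<close> is orthogonal to all of them, or they form a basis and
  some \<open>w\<close> has inner product \<open>1\<close> with each. With one vector more the conclusion may fail, as for a
  basis together with its negative sum.
\<close>
lemma few_vectors_in_halfspace:
  fixes V :: "'a::euclidean_space set"
  assumes "finite V" "card V \<le> DIM('a)"
  obtains w where "w \<noteq> 0" "\<And>v. v \<in> V \<Longrightarrow> 0 \<le> v \<bullet> w"
proof (cases "span V = UNIV")
  case False
  then obtain w where "w \<noteq> 0" "\<forall>x\<in>span V. w \<bullet> x = 0"
    using span_not_UNIV_orthogonal by blast
  then show ?thesis by (intro that[of w]) (auto simp: span_base inner_commute)
next
  case True
  then have "independent V"
    using card_le_dim_spanning[of V UNIV] assms by auto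
  then obtain g where g: "linear g" "\<forall>v\<in>V. g v = (1::real)"
    using linear_independent_extend[of V "\<lambda>_. 1"] by blast
  define w where "w = (\<Sum>b\<in>Basis. g b *\<^sub>R b)"
  have w: "v \<bullet> w = g v" for v
  proof -
    have "g v = g (\<Sum>b\<in>Basis. (v \<bullet> b) *\<^sub>R b)" by (simp add: euclidean_representation)
    also have "\<dots> = v \<bullet> w"
      by (simp add: w_def linear_sum[OF g(1)] linear_scale[OF g(1)] inner_sum_right mult.commute)
    finally show ?thesis by simp
  qed
  have "V \<noteq> {}"
  proof
    assume "V = {}"
    with True have "(UNIV :: 'a set) = {0}" by simp
    then show False by (metis UNIV_I nonzero_Basis singletonD some_in_eq nonempty_Basis)
  qed
  then have "w \<noteq> 0" using w g(2) by fastforce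
  then show ?thesis using w g(2) by (intro that[of w]) auto
qed

text \<open>
  The function \<open>- w \<bullet> x\<close> drops by \<open>4 e\<close> from \<open>x\<^sub>0\<close> to \<open>x\<^sub>0 + r w\<close>, whereas a convex element of the cusp
  algebra does not decrease between these points; so it cannot stay within \<open>e\<close> at both.
\<close>
lemma SG_set_card_gt:
  fixes K :: "'a::euclidean_space set"
  assumes K: "compact K" "convex K" "interior K \<noteq> {}"
    and D: "SG_set K (convex_functions K) D" "finite D"
  shows "DIM('a) < card D"
proof (rule ccontr)
  assume "\<not> DIM('a) < card D"
  then have card: "card D \<le> DIM('a)" by simp
  obtain x0 where x0: "x0 \<in> interior K" using K(3) by blast
  have D_convex: "D \<subseteq> convex_functions K"
    using D(1) unif_closure_convex_functions[OF K(1,2)] by (simp add: SG_set_def)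
  have "\<exists>v. \<forall>x\<in>K. f x0 + v \<bullet> (x - x0) \<le> f x" if "f \<in> D" for f
  proof -
    note f = convex_functionsD[OF K(1) subsetD[OF D_convex that]]
    show ?thesis
      by (rule convex_function_interior_subgradient[OF midpoint_convex_imp_convex_on[OF K(2) f] x0])
  qed
  then have "\<forall>f\<in>D. \<exists>v. \<forall>x\<in>K. f x0 + v \<bullet> (x - x0) \<le> f x" ..
  from bchoice[OF this] obtain v
    where v: "\<And>f x. f \<in> D \<Longrightarrow> x \<in> K \<Longrightarrow> f x0 + v f \<bullet> (x - x0) \<le> f x" by blast
  have "card (v ` D) \<le> DIM('a)" using card card_image_le[OF D(2), of v] by linarith
  from few_vectors_in_halfspace[OF finite_imageI[OF D(2)] this]
  obtain w where "w \<noteq> 0" "\<And>x. x \<in> v ` D \<Longrightarrow> 0 \<le> x \<bullet> w" by blast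
  then have w: "w \<noteq> 0" "\<And>f. f \<in> D \<Longrightarrow> 0 \<le> v f \<bullet> w" by blast+
  let ?A = "cusp_algebra K x0 w"
  have "f \<in> unif_closure K (?A \<inter> convex_functions K)" if "f \<in> D" for f
  proof -
    have f: "f \<in> convex_functions K" using D_convex that by blast
    then have "f \<in> C_space K" by (simp add: convex_functions_def)
    then show ?thesis
      using approximable_cusp_algebra[OF K(1,2) x0 f v[OF that] w(1) w(2)[OF that]]
      by (simp add: mem_unif_closure_algebra_convex[OF K(1)])
  qed
  then have approx: "convex_functions K \<subseteq> unif_closure K (?A \<inter> convex_functions K)"
    using D(1) unital_algebra_cusp_algebra[OF K(1) x0, of w] unfolding SG_set_def by blast
  have "(\<lambda>x\<in>K. - (w \<bullet> x)) \<in> convex_functions K"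
    unfolding restrict_mem_convex_functions[OF K(1,2)]
    by (auto simp: midpoint_convex_on_def midpoint_def inner_add_right add_divide_distrib intro!: continuous_intros)
  with approx have lin: "approximable K (?A \<inter> convex_functions K) (\<lambda>x\<in>K. - (w \<bullet> x))"
    using mem_unif_closure_algebra_convex[OF K(1)] by blast
  obtain r where r: "r > 0" "x0 + r *\<^sub>R w \<in> K"
  proof -
    obtain d where d: "d > 0" "cball x0 d \<subseteq> K" using x0 by (meson mem_interior_cball)
    then have "x0 + (d / norm w) *\<^sub>R w \<in> K"
      using w(1) by (intro subsetD[OF d(2)]) (simp add: dist_norm)
    then show thesis using that[of "d / norm w"] d(1) w(1) by simp
  qed
  define e where "e = r * (w \<bullet> w) / 4"
  have "e > 0" using r(1) w(1) by (simp add: e_def)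
  then obtain g where g: "g \<in> ?A" "g \<in> convex_functions K"
      "\<And>x. x \<in> K \<Longrightarrow> \<bar>(\<lambda>x\<in>K. - (w \<bullet> x)) x - g x\<bar> \<le> e"
    using lin unfolding approximable_def by blast
  note g' = convex_functionsD[OF K(1) g(2)]
  obtain b where "cusp (\<lambda>t. g (x0 + t *\<^sub>R w)) b" using g(1) by (auto simp: cusp_algebra_def)
  from convex_cusp_increasing[OF midpoint_convex_imp_convex_on[OF K(2) g'] x0 this r]
  have "g x0 \<le> g (x0 + r *\<^sub>R w)" .
  moreover have "x0 \<in> K" using x0 interior_subset by blast
  moreover have "w \<bullet> (x0 + r *\<^sub>R w) = w \<bullet> x0 + 4 * e" by (simp add: e_def inner_add_right)
  moreover from calculation have "\<bar>- (w \<bullet> x0) - g x0\<bar> \<le> e" using g(3)[of x0] by simp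
  moreover have "\<bar>- (w \<bullet> (x0 + r *\<^sub>R w)) - g (x0 + r *\<^sub>R w)\<bar> \<le> e"
    using g(3)[OF r(2)] r(2) by simp
  ultimately show False using \<open>e > 0\<close> by argo
qed

text \<open>
  A small step from an interior point along the \<open>i\<close>-th axis changes only the \<open>i\<close>-th coordinate
  function, and it decreases the negative sum, so these functions are pairwise distinct on \<open>K\<close>.
\<close>
lemma card_coordinate_functions:
  fixes K :: "(real ^ 'n::finite) set"
  assumes "interior K \<noteq> {}"
  shows "card (insert (neg_coord_sum K) (range (coord_fun K))) = CARD('n) + 1"
proof -
  obtain x0 d where d: "d > 0" "cball x0 d \<subseteq> K"
    using assms by (meson all_not_in_conv mem_interior_cball)
  have in_K: "x0 \<in> K" "x0 + d *\<^sub>R axis i 1 \<in> K" for i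
    using d by (auto simp: dist_norm intro!: subsetD[OF d(2)])
  have coord: "coord_fun K j (x0 + d *\<^sub>R axis i 1) - coord_fun K j x0 = (if i = j then d else 0)" for i j
    using in_K by (simp add: coord_fun_def axis_def)
  have neg: "neg_coord_sum K (x0 + d *\<^sub>R axis i 1) - neg_coord_sum K x0 = - d" for i
    using in_K by (simp add: neg_coord_sum_def axis_def sum.distrib flip: sum_distrib_left)
  have "inj (coord_fun K)"
  proof (rule injI)
    fix i j assume "coord_fun K i = coord_fun K j"
    then show "i = j" using coord[of i i] coord[of j i] d(1) by (simp split: if_splits)
  qed
  moreover have "neg_coord_sum K \<notin> range (coord_fun K)"
  proof
    assume "neg_coord_sum K \<in> range (coord_fun K)"
    then obtain j where "neg_coord_sum K = coord_fun K j" by blast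
    then show False using coord[of j j] neg[of j] d(1) by simp
  qed
  ultimately show ?thesis by (simp add: card_image)
qed

theorem theorem1:
  fixes K :: "(real ^ 'n::finite) set"
  assumes "compact K" and "convex K"
  shows "SG_set K (convex_functions K) (insert (neg_coord_sum K) (range (coord_fun K))) \<and>
    (interior K \<noteq> {} \<longrightarrow>
      (\<exists>D. SG_set K (convex_functions K) D \<and> finite D \<and> card D = CARD('n) + 1) \<and>
      (\<forall>D. SG_set K (convex_functions K) D \<and> finite D \<longrightarrow> CARD('n) + 1 \<le> card D))"
proof (intro conjI impI allI)
  show SG: "SG_set K (convex_functions K) (insert (neg_coord_sum K) (range (coord_fun K)))"
    by (rule coordinates_SG_set[OF assms])
  assume interior: "interior K \<noteq> {}"
  show "\<exists>D. SG_set K (convex_functions K) D \<and> finite D \<and> card D = CARD('n) + 1"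
    using SG card_coordinate_functions[OF interior] by (intro exI conjI) auto
  show "CARD('n) + 1 \<le> card D" if "SG_set K (convex_functions K) D \<and> finite D" for D
    using SG_set_card_gt[OF assms interior] that by (simp add: Suc_le_eq)
qed

end
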